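(* Let $(\tau_n)_{n\in\mathbb{N}}$ be, for each $\delta$, a random walk with $\tau_0=0$ and i.i.d. increments distributed as $\tau$, where $\mathsf{E}[\tau]=\delta\in(0,\infty)$, and suppose that $\mathsf{P}(\tau>0)=1$. Let $N(t)=\max\{n:\tau_n\le t\}$ and let $r\ge 1$. If $\mathsf{E}[\tau^{r+1}]=O(\delta^{r+1})$ as $\delta\to\infty$, then $$\frac{\delta\,N(t)}{t}\longrightarrow 1\quad\text{in } L^r\quad\text{as }\delta,t\to\infty\text{ such that }\delta=o(t).$$ When, in particular, $\mathsf{E}[|\tau-\delta|^{r\vee 2}]=O(\delta^{q_{r\vee 2}})$ with $q_{r\vee 2}\in[0,r\vee 2]$, then, as $\delta,t\to\infty$ such that $\delta=o(t)$, $$\mathsf{E}\Bigl[\Bigl|\frac{\delta\,N(t)}{t}-1\Bigr|^r\Bigr]=O\Bigl(\frac{\delta}{t}\Bigr)^{r}+O\Bigl(\frac{\delta^{\alpha_r}}{t}\Bigr)^{r/2},\qquad \alpha_r:=\frac{2\,q_{r\vee 2}}{r\vee 2}-1.$$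
   Context: For each value of $\delta>0$ (along values tending to infinity) there is a renewal process $(\tau_n)$, $\tau_0:=0$, whose increments $(\tau_n-\tau_{n-1})$ are i.i.d. copies of $\tau:=\tau_1$; the law of $\tau$ depends on $\delta$, and $\mathsf{Var}[\tau]<\infty$. Order statements "as $\delta\to\infty$" refer to this family of laws. Notation: $r\vee 2=\max\{r,2\}$; $O(x)^{a}$ denotes $(O(x))^a$; $N(t)=0$ if $\tau_1>t$. A statement "as $\delta,t\to\infty$ such that $\delta=o(t)$" refers to any joint limit in which $\delta\to\infty$, $t\to\infty$ and $\delta/t\to0$. *)

theory Defs
  imports "HOL-Probability.Probability" "HOL-Library.Landau_Symbols"
begin

definition random_walk :: "'a measure \<Rightarrow> (nat \<Rightarrow> 'a \<Rightarrow> real) \<Rightarrow> bool" where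
  "random_walk M \<tau> \<longleftrightarrow>
     prob_space M \<and>
     (\<forall>n. \<tau> n \<in> borel_measurable M) \<and>
     (\<forall>\<omega>\<in>space M. \<tau> 0 \<omega> = 0) \<and>
     prob_space.indep_vars M (\<lambda>_. borel) (\<lambda>n \<omega>. \<tau> (Suc n) \<omega> - \<tau> n \<omega>) UNIV \<and>
     (\<forall>n. distr M borel (\<lambda>\<omega>. \<tau> (Suc n) \<omega> - \<tau> n \<omega>) = distr M borel (\<tau> 1))"

text \<open>For \<open>t \<ge> 0\<close> the set contains \<open>0\<close>. For positive increments it is almost surely finite; on
  the exceptional null event \<open>Max\<close> takes an unspecified value.\<close>

definition renewal_count :: "(nat \<Rightarrow> 'a \<Rightarrow> real) \<Rightarrow> real \<Rightarrow> 'a \<Rightarrow> nat" where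
  "renewal_count \<tau> t \<omega> = Max {n. \<tau> n \<omega> \<le> t}"

definition to_infinity_along :: "real set \<Rightarrow> real filter" where
  "to_infinity_along D = inf at_top (principal D)"

text \<open>The joint limit of \<open>(\<delta>, t)\<close> with \<open>\<delta> \<in> D\<close>, \<open>\<delta> \<rightarrow> \<infinity>\<close>, \<open>t \<rightarrow> \<infinity>\<close> and \<open>\<delta> = o(t)\<close>: it is the
  largest filter under which all of these hold, so a statement along it covers every such
  joint limit.\<close>

definition joint_limit :: "real set \<Rightarrow> (real \<times> real) filter" where
  "joint_limit D =
     inf (filtercomap fst (to_infinity_along D))
       (inf (filtercomap snd at_top) (filtercomap (\<lambda>(\<delta>, t). \<delta> / t) (nhds 0)))"

text \<open>Convergence in \<open>L\<^sup>r\<close> to a constant, where the underlying probability space may vary with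
  the index. Integrability is demanded explicitly, as the Bochner integral of a non-integrable
  function is \<open>0\<close>.\<close>

definition tendsto_Lr ::
    "real \<Rightarrow> ('i \<Rightarrow> 'a measure) \<Rightarrow> ('i \<Rightarrow> 'a \<Rightarrow> real) \<Rightarrow> real \<Rightarrow> 'i filter \<Rightarrow> bool" where
  "tendsto_Lr r M X c F \<longleftrightarrow>
     (\<forall>\<^sub>F i in F. X i \<in> borel_measurable (M i) \<and>
        integrable (M i) (\<lambda>\<omega>. \<bar>X i \<omega> - c\<bar> powr r)) \<and>
     ((\<lambda>i. \<integral>\<omega>. \<bar>X i \<omega> - c\<bar> powr r \<partial>M i) \<longlongrightarrow> 0) F"

end

theory Submission
  imports Defs "HOL-Real_Asymp.Real_Asymp"
begin

text \<open>
  Put \<open>W n = \<tau> n - n \<delta>\<close> and \<open>N = N(t)\<close>. Since \<open>\<tau> N \<le> t < \<tau> (N + 1)\<close>, one has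
  \<open>\<bar>\<delta> N - t\<bar> \<le> \<delta> + max {\<bar>W n\<bar> |n. n \<le> L}\<close> as soon as \<open>N + 1 \<le> L\<close>; no estimate of the overshoot is
  needed. With \<open>L\<close> of order \<open>4 t / \<delta>\<close>, Doob's maximal inequality and a Marcinkiewicz--Zygmund bound give
  \<open>E max \<bar>W n\<bar>\<^sup>p = O(L powr (p / 2) * E \<bar>\<tau> - \<delta>\<bar>\<^sup>p)\<close> for \<open>p = max r 2\<close>, which yields the second
  error term. On \<open>N \<ge> L\<close> the increments being nonnegative with \<open>E \<tau>\<^sup>2 = O(\<delta>\<^sup>2)\<close>, Chernoff's bound makes
  \<open>P(N \<ge> n)\<close> exponentially small in \<open>n\<close>, so that this part is absorbed by \<open>(\<delta> / t) powr r\<close>. The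
  \<open>L\<^sup>r\<close> convergence is the case \<open>q = p\<close>, because \<open>p \<le> r + 1\<close>.
\<close>

section \<open>Elementary inequalities\<close>

text \<open>For negative \<open>u\<close> the claim follows from
  \<open>1 - u \<le> exp (- u)\<close>, because \<open>(1 + u + u\<^sup>2) * (1 - u)\<close> equals
  one minus the cube of \<open>u\<close> and so is at least 1. The bound serves twice: to expand
  powers to second order and to estimate a Laplace transform.\<close>

lemma exp_le_quadratic:
  fixes u :: real
  assumes "u \<le> 1"
  shows "exp u \<le> 1 + u + u\<^sup>2"
proof (cases "u \<ge> 0")
  case True
  then show ?thesis using assms exp_bound by simp
next
  case False
  have "1 \<le> (1 + u + u\<^sup>2) * (1 - u)"
  proof -
    have "(1 + u + u\<^sup>2) * (1 - u) = 1 + (- u) * u\<^sup>2"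
      by (simp add: algebra_simps power2_eq_square)
    then show ?thesis using False by (simp add: mult_nonpos_nonneg)
  qed
  also have "\<dots> \<le> (1 + u + u\<^sup>2) * exp (- u)"
  proof (rule mult_left_mono)
    show "1 - u \<le> exp (- u)" using exp_ge_add_one_self[of "- u"] by simp
    have "0 \<le> (u + 1/2)\<^sup>2" by simp
    then show "0 \<le> 1 + u + u\<^sup>2" by (simp add: power2_eq_square algebra_simps)
  qed
  finally show ?thesis by (simp add: exp_minus field_simps)
qed

text \<open>The factor \<open>1 + 1 / (2 n)\<close> is small enough for the bound \<open>O(n powr (p / 2))\<close> to survive
  the induction on the number of steps, already for \<open>p = 2\<close>.\<close>

lemma powr_abs_add_le_expansion:
  fixes p n x y :: real
  assumes p: "p \<ge> 2" and n: "n \<ge> 1"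
  shows "\<bar>x + y\<bar> powr p \<le> (1 + 1 / (2 * n)) * \<bar>x\<bar> powr p + p * (sgn x * \<bar>x\<bar> powr (p - 1)) * y
           + 2 * (2 * p) powr p * n powr (p / 2 - 1) * \<bar>y\<bar> powr p"
\<comment> \<open>When \<open>y\<close> dominates, the left side and the modulus of the linear term
  are each at most \<open>(2 * p) powr p * \<bar>y\<bar> powr p\<close>; this is the origin of the
  factor 2 in the last coefficient.\<close>
proof (cases "\<bar>x\<bar> < p * \<bar>y\<bar>")
  case True
  have n1: "1 \<le> n powr (p / 2 - 1)" using p n by (intro ge_one_powr_ge_zero) auto
  have "\<bar>x + y\<bar> powr p \<le> (2 * p * \<bar>y\<bar>) powr p"
  proof (rule powr_mono2)
    have "\<bar>x + y\<bar> \<le> (p + 1) * \<bar>y\<bar>" using True by (simp add: algebra_simps)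
    also have "\<dots> \<le> 2 * p * \<bar>y\<bar>" using p by (intro mult_right_mono) auto
    finally show "\<bar>x + y\<bar> \<le> 2 * p * \<bar>y\<bar>" .
  qed (use p in auto)
  also have "\<dots> = (2 * p) powr p * \<bar>y\<bar> powr p" using p by (simp add: powr_mult)
  finally have 1: "\<bar>x + y\<bar> powr p \<le> (2 * p) powr p * \<bar>y\<bar> powr p" .
  have "\<bar>p * (sgn x * \<bar>x\<bar> powr (p - 1)) * y\<bar> = p * \<bar>sgn x\<bar> * \<bar>x\<bar> powr (p - 1) * \<bar>y\<bar>"
    using p by (simp add: abs_mult)
  also have "\<dots> \<le> p * 1 * (p * \<bar>y\<bar>) powr (p - 1) * \<bar>y\<bar>"
    using p True by (intro mult_mono powr_mono2) (auto simp: abs_sgn_eq)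
  also have "\<dots> = (p * \<bar>y\<bar>) powr p"
    using p powr_mult_base[of "p * \<bar>y\<bar>" "p - 1"] by (simp add: mult_ac)
  also have "\<dots> \<le> (2 * p * \<bar>y\<bar>) powr p"
    using p by (intro powr_mono2 mult_right_mono) auto
  also have "\<dots> = (2 * p) powr p * \<bar>y\<bar> powr p" using p by (simp add: powr_mult)
  finally have 2: "- (p * (sgn x * \<bar>x\<bar> powr (p - 1)) * y) \<le> (2 * p) powr p * \<bar>y\<bar> powr p"
    by linarith
  have "2 * (2 * p) powr p * 1 * \<bar>y\<bar> powr p \<le> 2 * (2 * p) powr p * n powr (p / 2 - 1) * \<bar>y\<bar> powr p"
    using n1 by (intro mult_mono) auto
  moreover have "0 \<le> (1 + 1 / (2 * n)) * \<bar>x\<bar> powr p" using n by auto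
  ultimately show ?thesis using 1 2 by linarith
next
  case False
  show ?thesis
  proof (cases "x = 0")
    case True
    then have "y = 0" using False p by (auto simp: not_less mult_le_0_iff)
    then show ?thesis using True by simp
  next
    case x: False
    \<comment> \<open>After division by \<open>x\<close>, the bound \<open>1 + z \<le> exp z\<close>
      turns the power into \<open>exp (p * z)\<close>, and \<open>p * z \<le> 1\<close> admits the
      quadratic bound. What remains is the second-order term \<open>(p * z)\<^sup>2\<close>.\<close>
    define z where "z = y / x"
    have y: "y = x * z" using x by (simp add: z_def)
    have z: "p * \<bar>z\<bar> \<le> 1"
      using False x by (simp add: z_def abs_divide pos_divide_le_eq not_less)
    have "p * z \<le> p * \<bar>z\<bar>" using p by (auto intro!: mult_left_mono)
    then have pz: "p * z \<le> 1" using z by auto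
    have "2 * \<bar>z\<bar> \<le> p * \<bar>z\<bar>" using p by (intro mult_right_mono) auto
    then have z1: "0 \<le> 1 + z" using z by linarith
    have "\<bar>x + y\<bar> powr p = \<bar>x\<bar> powr p * (1 + z) powr p"
    proof -
      have "x + y = x * (1 + z)" by (simp add: y algebra_simps)
      then show ?thesis using z1 by (simp add: abs_mult powr_mult)
    qed
    also have "\<dots> \<le> \<bar>x\<bar> powr p * (exp z) powr p"
      using p z1 by (intro mult_left_mono powr_mono2) auto
    also have "\<dots> = \<bar>x\<bar> powr p * exp (p * z)" by (simp add: powr_def)
    also have "\<dots> \<le> \<bar>x\<bar> powr p * (1 + p * z + (p * z)\<^sup>2)"
      using exp_le_quadratic[OF pz] by (intro mult_left_mono) auto
    also have "\<dots> = \<bar>x\<bar> powr p + p * (\<bar>x\<bar> powr p * z) + \<bar>x\<bar> powr p * (p * z)\<^sup>2"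
      by (simp add: algebra_simps)
    also have "\<bar>x\<bar> powr p * z = (sgn x * \<bar>x\<bar> powr (p - 1)) * y"
    proof -
      have "\<bar>x\<bar> powr p = \<bar>x\<bar> powr (p - 1) * \<bar>x\<bar>"
        using powr_mult_base[of "\<bar>x\<bar>" "p - 1"] by (simp add: mult_ac)
      moreover have "\<bar>x\<bar> = sgn x * x" by (simp add: abs_sgn)
      ultimately show ?thesis by (simp add: y mult_ac)
    qed
    finally have main: "\<bar>x + y\<bar> powr p \<le> \<bar>x\<bar> powr p + p * ((sgn x * \<bar>x\<bar> powr (p - 1)) * y)
        + \<bar>x\<bar> powr p * (p * z)\<^sup>2" .
    have "\<bar>x\<bar> powr p * (p * z)\<^sup>2 \<le> 1 / (2 * n) * \<bar>x\<bar> powr p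
        + 2 * (2 * p) powr p * n powr (p / 2 - 1) * \<bar>y\<bar> powr p"
    \<comment> \<open>A small second-order term is absorbed into the factor
      \<open>1 + 1 / (2 * n)\<close>. Otherwise \<open>2 * p * sqrt n * \<bar>z\<bar>\<close> is at
      least 1, so multiplying by its power \<open>p - 2\<close> raises the exponent of
      \<open>\<bar>z\<bar>\<close> from 2 to \<open>p\<close> at the price of
      \<open>n powr (p / 2 - 1)\<close>.\<close>
    proof (cases "2 * (p * z)\<^sup>2 * n \<le> 1")
      case True
      have "(p * z)\<^sup>2 \<le> 1 / (2 * n)" using True n by (simp add: field_simps)
      then have "\<bar>x\<bar> powr p * (p * z)\<^sup>2 \<le> 1 / (2 * n) * \<bar>x\<bar> powr p"
        by (subst mult.commute) (rule mult_right_mono, auto)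
      moreover have "0 \<le> 2 * (2 * p) powr p * n powr (p / 2 - 1) * \<bar>y\<bar> powr p" by simp
      ultimately show ?thesis by linarith
    next
      case False
      have "(2 * p * sqrt n * \<bar>z\<bar>)\<^sup>2 = 4 * ((p * z)\<^sup>2 * n)"
        using n by (simp add: power_mult_distrib)
      then have "1 \<le> (2 * p * sqrt n * \<bar>z\<bar>)\<^sup>2"
        using False by linarith
      then have "1 \<le> 2 * p * sqrt n * \<bar>z\<bar>"
        using p n by (intro power2_le_imp_le[of 1]) auto
      then have "1 \<le> (2 * p * sqrt n * \<bar>z\<bar>) powr (p - 2)"
        using p by (intro ge_one_powr_ge_zero) auto
      then have "(p * z)\<^sup>2 * 1 \<le> (2 * p * \<bar>z\<bar>)\<^sup>2 * (2 * p * sqrt n * \<bar>z\<bar>) powr (p - 2)"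
        using p by (intro mult_mono) (auto simp: power_mult_distrib)
      also have "\<dots> = (2 * p * \<bar>z\<bar>)\<^sup>2 * (2 * p * \<bar>z\<bar>) powr (p - 2) * sqrt n powr (p - 2)"
      proof -
        have "2 * p * sqrt n * \<bar>z\<bar> = (2 * p * \<bar>z\<bar>) * sqrt n" by simp
        then show ?thesis using p n by (simp only: powr_mult mult.assoc)
      qed
      also have "(2 * p * \<bar>z\<bar>)\<^sup>2 * (2 * p * \<bar>z\<bar>) powr (p - 2) = (2 * p * \<bar>z\<bar>) powr p"
        using p by (cases "z = 0") (auto simp: powr_add[symmetric] powr_numeral[symmetric] simp del: powr_numeral)
      also have "sqrt n powr (p - 2) = n powr (p / 2 - 1)"
        using n by (simp add: powr_half_sqrt[symmetric] powr_powr field_simps)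
      finally have "\<bar>x\<bar> powr p * (p * z)\<^sup>2 \<le> \<bar>x\<bar> powr p * ((2 * p * \<bar>z\<bar>) powr p * n powr (p / 2 - 1))"
        by (intro mult_left_mono) auto
      also have "\<dots> = (2 * p) powr p * n powr (p / 2 - 1) * \<bar>y\<bar> powr p"
        using p by (simp add: y abs_mult powr_mult mult_ac)
      also have "\<dots> \<le> 2 * (2 * p) powr p * n powr (p / 2 - 1) * \<bar>y\<bar> powr p"
        by (simp add: mult_right_mono)
      finally show ?thesis using n by (simp add: add_increasing)
    qed
    then show ?thesis using main by (simp add: algebra_simps)
  qed
qed

text \<open>Pathwise form of Doob's inequality: \<open>s\<close> is the running maximum and \<open>y\<close>, \<open>y'\<close> are
  consecutive values of the submartingale.\<close>

lemma max_powr_step: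
  fixes p s y y' :: real
  assumes p: "p \<ge> 2" and s: "0 \<le> s" and y: "0 \<le> y'"
  shows "s powr (p - 1) * y - s powr p / 2 + s powr (p - 1) * (y' - y)
     \<le> max s y' powr (p - 1) * y' - max s y' powr p / 2"
proof (cases "y' \<le> s")
  case True
  then show ?thesis by (simp add: max_def algebra_simps)
next
  case False
  have *: "a powr p = a powr (p - 2) * a\<^sup>2" "a powr (p - 1) = a powr (p - 2) * a" if "0 \<le> a" for a :: real
    using that powr_mult_base[of a "p - 2"] powr_mult_base[of a "p - 1"]
    by (auto simp: power2_eq_square mult_ac)
  \<comment> \<open>The terms in \<open>y\<close> cancel, so for a new maximum \<open>y' > s\<close>
    the claim is that \<open>s powr (p - 1) * y'\<close> is at most the mean of
    \<open>s powr p\<close> and \<open>y' powr p\<close>. It comes from the arithmetic-geometric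
    mean inequality for \<open>s * y'\<close>.\<close>
  have "s powr (p - 1) * y' = s powr (p - 2) * (s * y')" using *(2)[OF s] by simp
  also have "\<dots> \<le> s powr (p - 2) * ((s\<^sup>2 + y'\<^sup>2) / 2)"
    using sum_squares_bound[of s y'] by (intro mult_left_mono) auto
  also have "\<dots> = (s powr p + s powr (p - 2) * y'\<^sup>2) / 2" using *(1)[OF s] by (simp add: algebra_simps)
  also have "s powr (p - 2) * y'\<^sup>2 \<le> y' powr (p - 2) * y'\<^sup>2"
    using False s p by (intro mult_right_mono powr_mono2) auto
  also have "\<dots> = y' powr p" using *(1)[OF y] by simp
  finally have "s powr (p - 1) * y' \<le> (s powr p + y' powr p) / 2" by simp
  moreover have "y' powr (p - 1) * y' = y' powr p" using *[OF y] by (simp add: power2_eq_square)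
  ultimately show ?thesis using False by (simp add: max_def algebra_simps)
qed

section \<open>Crude power inequalities for integrability and rescaling\<close>

lemma powr_le_add_powr:
  fixes x p q :: real
  assumes "0 \<le> x" "0 \<le> p" "p \<le> q"
  shows "x powr p \<le> 1 + x powr q"
proof (cases "x \<le> 1")
  case True
  then have "x powr p \<le> 1" using assms powr_le1 by simp
  then show ?thesis using powr_ge_zero[of x q] by linarith
next
  case False
  then have "x powr p \<le> x powr q" using assms by (intro powr_mono) auto
  then show ?thesis by simp
qed

lemma powr_mult_abs_le:
  fixes p s y :: real
  assumes "p \<ge> 1" "0 \<le> s"
  shows "s powr (p - 1) * \<bar>y\<bar> \<le> s powr p + \<bar>y\<bar> powr p"
proof (cases "s \<le> \<bar>y\<bar>")
  case True
  have "s powr (p - 1) * \<bar>y\<bar> \<le> \<bar>y\<bar> powr (p - 1) * \<bar>y\<bar>"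
    using True assms by (intro mult_right_mono powr_mono2) auto
  also have "\<dots> = \<bar>y\<bar> powr p" using powr_mult_base[of "\<bar>y\<bar>" "p - 1"] by (simp add: mult_ac)
  finally show ?thesis using powr_ge_zero[of s p] by linarith
next
  case False
  have "s powr (p - 1) * \<bar>y\<bar> \<le> s powr (p - 1) * s"
    using False assms by (intro mult_left_mono) auto
  also have "\<dots> = s powr p" using assms powr_mult_base[of s "p - 1"] by (simp add: mult_ac)
  finally show ?thesis using powr_ge_zero[of "\<bar>y\<bar>" p] by linarith
qed

lemma powr_abs_add_le_two:
  fixes p x y :: real
  assumes "p \<ge> 0"
  shows "\<bar>x + y\<bar> powr p \<le> 2 powr p * (\<bar>x\<bar> powr p + \<bar>y\<bar> powr p)"
proof -
  have "\<bar>x + y\<bar> powr p \<le> (2 * max \<bar>x\<bar> \<bar>y\<bar>) powr p"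
    using assms by (intro powr_mono2) auto
  also have "\<dots> = 2 powr p * max \<bar>x\<bar> \<bar>y\<bar> powr p" by (simp add: powr_mult)
  also have "max \<bar>x\<bar> \<bar>y\<bar> powr p \<le> \<bar>x\<bar> powr p + \<bar>y\<bar> powr p" by (simp add: max_def)
  finally show ?thesis by simp
qed

section \<open>A maximal inequality for centred random walks\<close>

locale centered_steps = prob_space +
  fixes X :: "nat \<Rightarrow> 'a \<Rightarrow> real" and p \<beta> :: real
  assumes indep: "indep_vars (\<lambda>_. borel) X UNIV"
    and p: "p \<ge> 2"
    and X_mean: "\<And>i. expectation (X i) = 0"
    and X_int: "\<And>i. integrable M (X i)"
    and X_powr_int: "\<And>i. integrable M (\<lambda>\<omega>. \<bar>X i \<omega>\<bar> powr p)"
    and X_powr_le: "\<And>i. expectation (\<lambda>\<omega>. \<bar>X i \<omega>\<bar> powr p) \<le> \<beta>"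
begin

section \<open>The walk, its running maximum and their integrability\<close>

definition walk :: "nat \<Rightarrow> 'a \<Rightarrow> real" where
  "walk n \<omega> = (\<Sum>i<n. X i \<omega>)"

definition sup_walk :: "nat \<Rightarrow> 'a \<Rightarrow> real" where
  "sup_walk n \<omega> = (MAX k\<in>{..n}. \<bar>walk k \<omega>\<bar>)"

lemma X_measurable [measurable]: "X i \<in> borel_measurable M"
  using X_int by (rule borel_measurable_integrable)

lemma walk_measurable [measurable]: "walk n \<in> borel_measurable M"
  unfolding walk_def by measurable

lemma walk_0 [simp]: "walk 0 \<omega> = 0"
  by (simp add: walk_def)

lemma walk_Suc: "walk (Suc n) \<omega> = walk n \<omega> + X n \<omega>"
  by (simp add: walk_def)

lemma sup_walk_0 [simp]: "sup_walk 0 \<omega> = 0"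
  by (simp add: sup_walk_def)

lemma sup_walk_Suc: "sup_walk (Suc n) \<omega> = max (sup_walk n \<omega>) \<bar>walk (Suc n) \<omega>\<bar>"
  by (simp add: sup_walk_def atMost_Suc max.commute)

lemma abs_walk_le_sup_walk: "k \<le> n \<Longrightarrow> \<bar>walk k \<omega>\<bar> \<le> sup_walk n \<omega>"
  unfolding sup_walk_def by (intro Max_ge) auto

lemma sup_walk_nonneg: "0 \<le> sup_walk n \<omega>"
  using abs_walk_le_sup_walk[of 0 n \<omega>] by simp

lemma sup_walk_measurable [measurable]: "sup_walk n \<in> borel_measurable M"
proof (induction n)
  case 0
  then show ?case by (simp add: sup_walk_def[abs_def])
next
  case (Suc n)
  have "sup_walk (Suc n) = (\<lambda>\<omega>. max (sup_walk n \<omega>) \<bar>walk (Suc n) \<omega>\<bar>)"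
    by (intro ext sup_walk_Suc)
  then show ?case using Suc by simp
qed

lemma nonneg_beta: "0 \<le> \<beta>"
  using X_powr_le[of 0] by (rule order_trans[rotated]) simp

lemma walk_powr_int: "integrable M (\<lambda>\<omega>. \<bar>walk n \<omega>\<bar> powr p)"
proof (induction n)
  case (Suc n)
  have "integrable M (\<lambda>\<omega>. 2 powr p * (\<bar>walk n \<omega>\<bar> powr p + \<bar>X n \<omega>\<bar> powr p))"
    using Suc X_powr_int by (intro integrable_mult_right Bochner_Integration.integrable_add)
  then show ?case
    by (rule Bochner_Integration.integrable_bound) (use p in \<open>auto simp: walk_Suc powr_abs_add_le_two\<close>)
qed simp

lemma sup_walk_powr_int: "integrable M (\<lambda>\<omega>. sup_walk n \<omega> powr p)"
proof (induction n)
  case (Suc n)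
  have "integrable M (\<lambda>\<omega>. sup_walk n \<omega> powr p + \<bar>walk (Suc n) \<omega>\<bar> powr p)"
    using Suc walk_powr_int by (rule Bochner_Integration.integrable_add)
  then show ?case
    by (rule Bochner_Integration.integrable_bound) (auto simp: sup_walk_Suc max_def)
qed simp

text \<open>The martingale property without conditional expectations: \<open>g\<close> depends on
  the steps before \<open>n\<close> alone, hence is independent of the centred variable
  \<open>X n\<close>. The growth condition matches the weights of order \<open>p - 1\<close> that
  occur below and gives integrability of \<open>g\<close>, since
  \<open>f \<omega> powr (p - 1) \<le> 1 + f \<omega> powr p\<close>.\<close>

lemma
  fixes h :: "(nat \<Rightarrow> real) \<Rightarrow> real"
  assumes h: "h \<in> borel_measurable (PiM {..<n} (\<lambda>_. borel))"
    and g: "\<And>\<omega>. g \<omega> = h (\<lambda>i\<in>{..<n}. X i \<omega>)"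
    and bound: "integrable M (\<lambda>\<omega>. f \<omega> powr p)" "\<And>\<omega>. 0 \<le> f \<omega>" "\<And>\<omega>. \<bar>g \<omega>\<bar> \<le> f \<omega> powr (p - 1)"
  shows past_mult_int: "integrable M (\<lambda>\<omega>. g \<omega> * X n \<omega>)"
    and past_mult_mean: "expectation (\<lambda>\<omega>. g \<omega> * X n \<omega>) = 0"
proof -
  have "indep_var (PiM {..<n} (\<lambda>_. borel)) (\<lambda>\<omega>. \<lambda>i\<in>{..<n}. X i \<omega>) (PiM {n} (\<lambda>_. borel)) (\<lambda>\<omega>. \<lambda>i\<in>{n}. X i \<omega>)"
    using indep by (rule indep_var_restrict) auto
  then have "indep_var borel (h \<circ> (\<lambda>\<omega>. \<lambda>i\<in>{..<n}. X i \<omega>)) borel ((\<lambda>x. x n) \<circ> (\<lambda>\<omega>. \<lambda>i\<in>{n}. X i \<omega>))"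
    by (rule indep_var_compose) (use h in auto)
  moreover have "h \<circ> (\<lambda>\<omega>. \<lambda>i\<in>{..<n}. X i \<omega>) = g" by (auto simp: g)
  moreover have "(\<lambda>x. x n) \<circ> (\<lambda>\<omega>. \<lambda>i\<in>{n}. X i \<omega>) = X n" by auto
  ultimately have ind: "indep_var borel g borel (X n)" by simp
  then have [measurable]: "g \<in> borel_measurable M"
    by (auto simp: indep_var_eq)
  have "integrable M (\<lambda>\<omega>. 1 + f \<omega> powr p)" using bound by simp
  then have gi: "integrable M g"
  proof (rule Bochner_Integration.integrable_bound)
    have "\<bar>g \<omega>\<bar> \<le> 1 + f \<omega> powr p" for \<omega>
      using bound(3)[of \<omega>] powr_le_add_powr[OF bound(2)[of \<omega>], of "p - 1" p] p by simp
    then show "AE \<omega> in M. norm (g \<omega>) \<le> norm (1 + f \<omega> powr p)"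
      by (intro AE_I2) (simp add: add_nonneg_nonneg)
  qed measurable
  show "integrable M (\<lambda>\<omega>. g \<omega> * X n \<omega>)"
    using ind gi X_int by (rule indep_var_integrable)
  show "expectation (\<lambda>\<omega>. g \<omega> * X n \<omega>) = 0"
    using indep_var_lebesgue_integral[OF ind gi X_int] X_mean by simp
qed

text \<open>The walk as a function on the product space of steps. It exhibits the weights below as
  measurable functions \<open>h\<close> of the past, as \<open>past_mult_mean\<close>
  demands.\<close>

definition partial_sum :: "(nat \<Rightarrow> real) \<Rightarrow> nat \<Rightarrow> real" where
  "partial_sum x k = (\<Sum>i<k. x i)"

lemma partial_sum_measurable: "k \<le> n \<Longrightarrow> (\<lambda>x. partial_sum x k) \<in> borel_measurable (PiM {..<n} (\<lambda>_. borel))"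
  unfolding partial_sum_def by (intro borel_measurable_sum measurable_component_singleton) auto

lemma walk_eq_partial_sum: "k \<le> n \<Longrightarrow> walk k \<omega> = partial_sum (\<lambda>i\<in>{..<n}. X i \<omega>) k"
  unfolding partial_sum_def walk_def by (intro sum.cong) auto

lemma sup_walk_eq_partial_sum: "sup_walk n \<omega> = (MAX k\<in>{..n}. \<bar>partial_sum (\<lambda>i\<in>{..<n}. X i \<omega>) k\<bar>)"
  unfolding sup_walk_def by (intro arg_cong[where f = Max] image_cong) (auto simp: walk_eq_partial_sum)

text \<open>Induction through \<open>powr_abs_add_le_expansion\<close>, whose linear term has mean
  zero by \<open>past_mult_mean\<close>. The excess \<open>1 / (2 * n)\<close> and the new step each
  contribute at most \<open>2 * ?C * real n powr (p / 2 - 1) * \<beta>\<close>. Together these turn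
  \<open>n powr (p / 2)\<close> into \<open>n powr (p / 2 - 1) * (n + 1)\<close>, which is at most
  \<open>(n + 1) powr (p / 2)\<close> because \<open>p \<ge> 2\<close>.\<close>

lemma expectation_walk_powr_le:
  "expectation (\<lambda>\<omega>. \<bar>walk n \<omega>\<bar> powr p) \<le> 4 * (2 * p) powr p * real n powr (p / 2) * \<beta>"
proof (induction n)
  case (Suc n)
  let ?C = "(2 * p) powr p"
  have C: "1 \<le> ?C" using p by (intro ge_one_powr_ge_zero) auto
  show ?case
  \<comment> \<open>The expansion requires \<open>n \<ge> 1\<close>, so the first step is estimated
    directly.\<close>
  proof (cases "n = 0")
    case True
    have "expectation (\<lambda>\<omega>. \<bar>X 0 \<omega>\<bar> powr p) \<le> 1 * \<beta>" using X_powr_le by simp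
    also have "\<dots> \<le> 4 * ?C * \<beta>" using C nonneg_beta by (intro mult_right_mono) auto
    finally show ?thesis using True by (simp add: walk_Suc)
  next
    case False
    define g where "g \<omega> = sgn (walk n \<omega>) * \<bar>walk n \<omega>\<bar> powr (p - 1)" for \<omega>
    have gX: "integrable M (\<lambda>\<omega>. g \<omega> * X n \<omega>)" "expectation (\<lambda>\<omega>. g \<omega> * X n \<omega>) = 0"
    proof -
      have h: "(\<lambda>x. sgn (partial_sum x n) * \<bar>partial_sum x n\<bar> powr (p - 1)) \<in> borel_measurable (PiM {..<n} (\<lambda>_. borel))"
        using partial_sum_measurable[of n n] by measurable
      have "\<bar>g \<omega>\<bar> \<le> \<bar>walk n \<omega>\<bar> powr (p - 1)" for \<omega>
        by (simp add: g_def abs_mult abs_sgn_eq)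
      moreover have "g \<omega> = sgn (partial_sum (\<lambda>i\<in>{..<n}. X i \<omega>) n) * \<bar>partial_sum (\<lambda>i\<in>{..<n}. X i \<omega>) n\<bar> powr (p - 1)" for \<omega>
        by (simp add: g_def walk_eq_partial_sum[of n n])
      ultimately show "integrable M (\<lambda>\<omega>. g \<omega> * X n \<omega>)" "expectation (\<lambda>\<omega>. g \<omega> * X n \<omega>) = 0"
        using past_mult_int[OF h _ walk_powr_int[of n]] past_mult_mean[OF h _ walk_powr_int[of n]]
        by auto
    qed
    have "expectation (\<lambda>\<omega>. \<bar>walk (Suc n) \<omega>\<bar> powr p) \<le>
        expectation (\<lambda>\<omega>. (1 + 1 / (2 * real n)) * \<bar>walk n \<omega>\<bar> powr p + p * (g \<omega> * X n \<omega>)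
           + 2 * ?C * real n powr (p / 2 - 1) * \<bar>X n \<omega>\<bar> powr p)"
    proof (rule integral_mono)
      show "integrable M (\<lambda>\<omega>. (1 + 1 / (2 * real n)) * \<bar>walk n \<omega>\<bar> powr p + p * (g \<omega> * X n \<omega>)
           + 2 * ?C * real n powr (p / 2 - 1) * \<bar>X n \<omega>\<bar> powr p)"
        using gX walk_powr_int X_powr_int
        by (intro Bochner_Integration.integrable_add integrable_mult_right) auto
      show "\<bar>walk (Suc n) \<omega>\<bar> powr p \<le> (1 + 1 / (2 * real n)) * \<bar>walk n \<omega>\<bar> powr p + p * (g \<omega> * X n \<omega>)
           + 2 * ?C * real n powr (p / 2 - 1) * \<bar>X n \<omega>\<bar> powr p" for \<omega>
        using powr_abs_add_le_expansion[OF p, of "real n" "walk n \<omega>" "X n \<omega>"] False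
        by (simp add: walk_Suc g_def mult.assoc)
    qed (rule walk_powr_int)
    also have "\<dots> = (1 + 1 / (2 * real n)) * expectation (\<lambda>\<omega>. \<bar>walk n \<omega>\<bar> powr p)
        + 2 * ?C * real n powr (p / 2 - 1) * expectation (\<lambda>\<omega>. \<bar>X n \<omega>\<bar> powr p)"
      using gX walk_powr_int X_powr_int by simp
    also have "\<dots> \<le> (1 + 1 / (2 * real n)) * (4 * ?C * real n powr (p / 2) * \<beta>)
        + 2 * ?C * real n powr (p / 2 - 1) * \<beta>"
      using Suc X_powr_le by (intro add_mono mult_left_mono) auto
    also have "\<dots> = 4 * ?C * \<beta> * (real n powr (p / 2 - 1) * (real n + 1))"
    proof -
      have "real n powr (p / 2) = real n powr (p / 2 - 1) * real n"
        using powr_mult_base[of "real n" "p / 2 - 1"] by (simp add: mult_ac)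
      then show ?thesis using False by (simp add: field_simps)
    qed
    also have "\<dots> \<le> 4 * ?C * \<beta> * (real (Suc n) powr (p / 2 - 1) * real (Suc n))"
      using p nonneg_beta by (intro mult_left_mono mult_mono powr_mono2) auto
    also have "real (Suc n) powr (p / 2 - 1) * real (Suc n) = real (Suc n) powr (p / 2)"
      using powr_mult_base[of "real (Suc n)" "p / 2 - 1"] by (simp only: mult_ac) simp
    finally show ?thesis by (simp add: mult_ac)
  qed
qed simp

lemma sup_walk_walk_int: "integrable M (\<lambda>\<omega>. sup_walk n \<omega> powr (p - 1) * \<bar>walk k \<omega>\<bar>)"
proof (rule Bochner_Integration.integrable_bound)
  show "integrable M (\<lambda>\<omega>. sup_walk n \<omega> powr p + \<bar>walk k \<omega>\<bar> powr p)"
    using sup_walk_powr_int walk_powr_int by (rule Bochner_Integration.integrable_add)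
qed (use p powr_mult_abs_le[OF _ sup_walk_nonneg] in \<open>auto simp: add_nonneg_nonneg abs_mult\<close>)

text \<open>The difference of the two sides vanishes at \<open>n = 0\<close> and does not decrease
  with \<open>n\<close>. By \<open>max_powr_step\<close> its increment is at least the mean of
  \<open>sup_walk n \<omega> powr (p - 1)\<close> times the increment of
  \<open>\<bar>walk n \<omega>\<bar>\<close>, and this is bounded below by a mean that vanishes by
  independence.\<close>

lemma expectation_sup_walk_powr_le_mult:
  "expectation (\<lambda>\<omega>. sup_walk n \<omega> powr p) / 2 \<le> expectation (\<lambda>\<omega>. sup_walk n \<omega> powr (p - 1) * \<bar>walk n \<omega>\<bar>)"
proof (induction n)
  case (Suc n)
  define g where "g \<omega> = sup_walk n \<omega> powr (p - 1) * sgn (walk n \<omega>)" for \<omega>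
  have gX: "integrable M (\<lambda>\<omega>. g \<omega> * X n \<omega>)" "expectation (\<lambda>\<omega>. g \<omega> * X n \<omega>) = 0"
  proof -
    have h: "(\<lambda>x. (MAX k\<in>{..n}. \<bar>partial_sum x k\<bar>) powr (p - 1) * sgn (partial_sum x n))
        \<in> borel_measurable (PiM {..<n} (\<lambda>_. borel))"
      using partial_sum_measurable[of _ n] by (intro borel_measurable_times powr_real_measurable borel_measurable_Max) auto
    have "\<bar>g \<omega>\<bar> \<le> sup_walk n \<omega> powr (p - 1)" for \<omega>
      by (simp add: g_def abs_mult abs_sgn_eq)
    moreover have "g \<omega> = (MAX k\<in>{..n}. \<bar>partial_sum (\<lambda>i\<in>{..<n}. X i \<omega>) k\<bar>) powr (p - 1)
        * sgn (partial_sum (\<lambda>i\<in>{..<n}. X i \<omega>) n)" for \<omega>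
      by (simp add: g_def walk_eq_partial_sum[of n n] sup_walk_eq_partial_sum)
    ultimately show "integrable M (\<lambda>\<omega>. g \<omega> * X n \<omega>)" "expectation (\<lambda>\<omega>. g \<omega> * X n \<omega>) = 0"
      using past_mult_int[OF h _ sup_walk_powr_int[of n] sup_walk_nonneg[of n]]
        past_mult_mean[OF h _ sup_walk_powr_int[of n] sup_walk_nonneg[of n]]
      by auto
  qed
  have "0 \<le> expectation (\<lambda>\<omega>. sup_walk n \<omega> powr (p - 1) * \<bar>walk n \<omega>\<bar> - sup_walk n \<omega> powr p / 2 + g \<omega> * X n \<omega>)"
    using Suc gX sup_walk_powr_int[of n] sup_walk_walk_int[of n n] by simp
  also have "\<dots> \<le> expectation (\<lambda>\<omega>. sup_walk (Suc n) \<omega> powr (p - 1) * \<bar>walk (Suc n) \<omega>\<bar> - sup_walk (Suc n) \<omega> powr p / 2)"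
  proof (rule integral_mono)
    fix \<omega>
    \<comment> \<open>Convexity of the absolute value, with \<open>sgn\<close> as subgradient (the
      value 0 at the origin is admissible), replaces the submartingale property.\<close>
    have "sgn (walk n \<omega>) * X n \<omega> \<le> \<bar>walk (Suc n) \<omega>\<bar> - \<bar>walk n \<omega>\<bar>"
      by (auto simp: walk_Suc sgn_if)
    then have "sup_walk n \<omega> powr (p - 1) * (sgn (walk n \<omega>) * X n \<omega>)
       \<le> sup_walk n \<omega> powr (p - 1) * (\<bar>walk (Suc n) \<omega>\<bar> - \<bar>walk n \<omega>\<bar>)"
      by (rule mult_left_mono) auto
    then show "sup_walk n \<omega> powr (p - 1) * \<bar>walk n \<omega>\<bar> - sup_walk n \<omega> powr p / 2 + g \<omega> * X n \<omega>
      \<le> sup_walk (Suc n) \<omega> powr (p - 1) * \<bar>walk (Suc n) \<omega>\<bar> - sup_walk (Suc n) \<omega> powr p / 2"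
      using max_powr_step[OF p sup_walk_nonneg[of n \<omega>], of "\<bar>walk (Suc n) \<omega>\<bar>" "\<bar>walk n \<omega>\<bar>"]
      by (simp add: g_def sup_walk_Suc mult.assoc)
  qed (use gX sup_walk_powr_int sup_walk_walk_int in auto)
  also have "\<dots> = expectation (\<lambda>\<omega>. sup_walk (Suc n) \<omega> powr (p - 1) * \<bar>walk (Suc n) \<omega>\<bar>)
      - expectation (\<lambda>\<omega>. sup_walk (Suc n) \<omega> powr p) / 2"
    using sup_walk_powr_int[of "Suc n"] sup_walk_walk_int[of "Suc n" "Suc n"] by simp
  finally show ?case by simp
qed simp

text \<open>Young's inequality with weight 1/4 on the maximum lets a quarter of its moment be
  absorbed into the half on the left. The remaining factor \<open>4 * 4 powr (p - 1)\<close>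
  combines with \<open>(2 * p) powr p\<close> to \<open>(8 * p) powr p\<close>.\<close>

lemma expectation_sup_walk_powr_le:
  "expectation (\<lambda>\<omega>. sup_walk n \<omega> powr p) \<le> 4 * (8 * p) powr p * real n powr (p / 2) * \<beta>"
proof -
  have young: "s powr (p - 1) * y \<le> s powr p / 4 + 4 powr (p - 1) * y powr p"
    if "0 \<le> s" "0 \<le> y" for s y :: real
  proof (cases "4 * y \<le> s")
    case True
    have "s powr (p - 1) * y \<le> s powr (p - 1) * (s / 4)" using True by (intro mult_left_mono) auto
    also have "\<dots> = s powr p / 4" using that powr_mult_base[of s "p - 1"] by (simp add: mult_ac)
    finally show ?thesis by (simp add: add_increasing2)
  next
    case False
    have "s powr (p - 1) * y \<le> (4 * y) powr (p - 1) * y"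
      using False that p by (intro mult_right_mono powr_mono2) auto
    also have "\<dots> = 4 powr (p - 1) * y powr p"
      using that powr_mult_base[of y "p - 1"] by (simp add: powr_mult mult_ac)
    finally show ?thesis by (simp add: add_increasing)
  qed
  have "expectation (\<lambda>\<omega>. sup_walk n \<omega> powr p) / 2
      \<le> expectation (\<lambda>\<omega>. sup_walk n \<omega> powr (p - 1) * \<bar>walk n \<omega>\<bar>)"
    by (rule expectation_sup_walk_powr_le_mult)
  also have "\<dots> \<le> expectation (\<lambda>\<omega>. sup_walk n \<omega> powr p / 4 + 4 powr (p - 1) * \<bar>walk n \<omega>\<bar> powr p)"
    using sup_walk_powr_int[of n] sup_walk_walk_int[of n n] walk_powr_int[of n] young sup_walk_nonneg
    by (intro integral_mono) auto
  also have "\<dots> = expectation (\<lambda>\<omega>. sup_walk n \<omega> powr p) / 4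
      + 4 powr (p - 1) * expectation (\<lambda>\<omega>. \<bar>walk n \<omega>\<bar> powr p)"
    using sup_walk_powr_int[of n] walk_powr_int[of n] by simp
  finally have "expectation (\<lambda>\<omega>. sup_walk n \<omega> powr p)
      \<le> 4 * 4 powr (p - 1) * expectation (\<lambda>\<omega>. \<bar>walk n \<omega>\<bar> powr p)" by simp
  also have "\<dots> \<le> 4 * 4 powr (p - 1) * (4 * (2 * p) powr p * real n powr (p / 2) * \<beta>)"
    by (intro mult_left_mono expectation_walk_powr_le) auto
  also have "4 * 4 powr (p - 1) = (4::real) powr p" by (simp add: powr_mult_base)
  also have "4 powr p * (4 * (2 * p) powr p * real n powr (p / 2) * \<beta>)
      = 4 * (8 * p) powr p * real n powr (p / 2) * \<beta>"
    using p powr_mult[of 4 "2 * p" p] by simp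
  finally show ?thesis .
qed

end

section \<open>Moments of the renewal count at a fixed level\<close>

text \<open>Bounds the contribution of large counts, uniformly in \<delta> and \<open>t\<close>. The
  rate \<open>1 / (8 * B)\<close> is half the Chernoff rate \<open>1 / (4 * B)\<close>; the other
  half pays for the factor that depends on \<open>t\<close>.\<close>

definition exp_series :: "real \<Rightarrow> real \<Rightarrow> real" where
  "exp_series B r = (\<Sum>n. real n powr r * exp (- (real n / (8 * B))))"

lemma summable_exp_series:
  assumes "B > 0"
  shows "summable (\<lambda>n. real n powr r * exp (- (real n / (8 * B))))"
proof (rule summable_comparison_test_bigo)
  define c where "c = 1 / (8 * B)"
  have c: "c > 0" using assms by (simp add: c_def)
  have "(\<lambda>n. real n powr r * exp (- (c * real n))) \<in> O(\<lambda>n. 1 / real n ^ 2)"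
    using c by real_asymp
  then show "(\<lambda>n. real n powr r * exp (- (real n / (8 * B)))) \<in> O(\<lambda>n. 1 / real n ^ 2)"
    by (simp add: c_def)
  show "summable (\<lambda>n. norm (1 / real n ^ 2))"
    using inverse_power_summable[of 2, where 'a = real] by (simp add: inverse_eq_divide)
qed

text \<open>One member of the family at fixed \<delta>. The second moment is measured on the scale
  \<open>\<delta>\<^sup>2\<close> by a parameter \<open>B\<close>, so that a single \<open>B\<close>
  can later serve all large \<delta>.\<close>

locale renewal_walk =
  fixes M :: "'a measure" and \<tau> :: "nat \<Rightarrow> 'a \<Rightarrow> real" and \<delta> B :: real
  assumes random_walk: "random_walk M \<tau>"
    and \<delta>_pos: "0 < \<delta>"
    and mean_int: "integrable M (\<tau> 1)"
    and mean: "(\<integral>\<omega>. \<tau> 1 \<omega> \<partial>M) = \<delta>"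
    and nonneg: "AE \<omega> in M. 0 \<le> \<tau> 1 \<omega>"
    and sq_int: "integrable M (\<lambda>\<omega>. (\<tau> 1 \<omega>)\<^sup>2)"
    and sq_le: "(\<integral>\<omega>. (\<tau> 1 \<omega>)\<^sup>2 \<partial>M) \<le> B * \<delta>\<^sup>2"
    and B_pos: "0 < B"

sublocale renewal_walk \<subseteq> prob_space M
  using random_walk by (simp add: random_walk_def)

context renewal_walk
begin

section \<open>Independent increments and their common law\<close>

definition step :: "nat \<Rightarrow> 'a \<Rightarrow> real" where
  "step n \<omega> = \<tau> (Suc n) \<omega> - \<tau> n \<omega>"

lemma \<tau>_measurable [measurable]: "\<tau> n \<in> borel_measurable M"
  using random_walk by (simp add: random_walk_def)

lemma step_measurable [measurable]: "step n \<in> borel_measurable M"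
  unfolding step_def[abs_def] by measurable

lemma indep_step: "indep_vars (\<lambda>_. borel) step UNIV"
  using random_walk by (simp add: random_walk_def step_def[abs_def])

lemma \<tau>_eq_sum: "\<omega> \<in> space M \<Longrightarrow> \<tau> n \<omega> = (\<Sum>i<n. step i \<omega>)"
  using random_walk sum_lessThan_telescope[of "\<lambda>n. \<tau> n \<omega>" n]
  by (simp add: step_def random_walk_def)

lemma distr_step: "distr M borel (step n) = distr M borel (\<tau> 1)"
  using random_walk by (simp add: random_walk_def step_def[abs_def])

lemma
  fixes f :: "real \<Rightarrow> real"
  assumes [measurable]: "f \<in> borel_measurable borel"
  shows integrable_step_iff: "integrable M (\<lambda>\<omega>. f (step n \<omega>)) \<longleftrightarrow> integrable M (\<lambda>\<omega>. f (\<tau> 1 \<omega>))"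
    and expectation_step: "expectation (\<lambda>\<omega>. f (step n \<omega>)) = expectation (\<lambda>\<omega>. f (\<tau> 1 \<omega>))"
  using integrable_distr_eq[of "step n" M borel f] integrable_distr_eq[of "\<tau> 1" M borel f]
    integral_distr[of "step n" M borel f] integral_distr[of "\<tau> 1" M borel f]
  by (simp_all add: distr_step)

text \<open>Chernoff's bound for the lower tail. Nonnegativity of the increments makes the exponent
  \<open>- (l * \<tau> 1 \<omega>)\<close> nonpositive, so the quadratic bound on \<open>exp\<close>
  applies with only two moments.\<close>

lemma prob_le_exp: "prob {\<omega> \<in> space M. \<tau> n \<omega> \<le> t} \<le> exp (t / (2 * B * \<delta>) - real n / (4 * B))"
proof -
  \<comment> \<open>The minimiser of
    \<open>- l * \<delta> + l\<^sup>2 * (B * \<delta>\<^sup>2)\<close>; the minimum is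
    \<open>- 1 / (4 * B)\<close>.\<close>
  define l where "l = 1 / (2 * B * \<delta>)"
  have l: "0 < l" using B_pos \<delta>_pos by (simp add: l_def)
  have exp_int: "integrable M (\<lambda>\<omega>. exp (- (l * \<tau> 1 \<omega>)))"
    by (rule Bochner_Integration.integrable_bound[of _ "\<lambda>_. 1::real"]) (use nonneg l in auto)
  have "expectation (\<lambda>\<omega>. exp (- (l * \<tau> 1 \<omega>))) \<le> expectation (\<lambda>\<omega>. 1 - l * \<tau> 1 \<omega> + l\<^sup>2 * (\<tau> 1 \<omega>)\<^sup>2)"
  proof (rule integral_mono_AE[OF exp_int])
    show "integrable M (\<lambda>\<omega>. 1 - l * \<tau> 1 \<omega> + l\<^sup>2 * (\<tau> 1 \<omega>)\<^sup>2)"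
      using mean_int sq_int by simp
    show "AE \<omega> in M. exp (- (l * \<tau> 1 \<omega>)) \<le> 1 - l * \<tau> 1 \<omega> + l\<^sup>2 * (\<tau> 1 \<omega>)\<^sup>2"
      using nonneg
    proof (rule AE_mp, intro AE_I2 impI)
      fix \<omega> assume "0 \<le> \<tau> 1 \<omega>"
      then have "0 \<le> l * \<tau> 1 \<omega>" using l by simp
      then show "exp (- (l * \<tau> 1 \<omega>)) \<le> 1 - l * \<tau> 1 \<omega> + l\<^sup>2 * (\<tau> 1 \<omega>)\<^sup>2"
        using exp_le_quadratic[of "- (l * \<tau> 1 \<omega>)"] by (simp add: power_mult_distrib)
    qed
  qed
  also have "\<dots> = 1 - l * \<delta> + l\<^sup>2 * expectation (\<lambda>\<omega>. (\<tau> 1 \<omega>)\<^sup>2)"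
    using mean_int sq_int mean by (simp add: prob_space)
  also have "\<dots> \<le> 1 - l * \<delta> + l\<^sup>2 * (B * \<delta>\<^sup>2)"
    using sq_le by (intro add_left_mono mult_left_mono) auto
  also have "\<dots> = 1 - 1 / (4 * B)"
    using B_pos \<delta>_pos by (simp add: l_def field_simps power2_eq_square)
  also have "\<dots> \<le> exp (- (1 / (4 * B)))"
    using exp_ge_add_one_self[of "- (1 / (4 * B))"] by simp
  finally have 1: "expectation (\<lambda>\<omega>. exp (- (l * \<tau> 1 \<omega>))) \<le> exp (- (1 / (4 * B)))" .
  have exp_step: "integrable M (\<lambda>\<omega>. exp (- (l * step i \<omega>)))" for i
    using exp_int integrable_step_iff[of "\<lambda>x. exp (- (l * x))" i] by simp
  have ind: "indep_vars (\<lambda>_. borel) (\<lambda>i \<omega>. exp (- (l * step i \<omega>))) {..<n}"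
    by (rule indep_vars_compose2[OF indep_vars_subset[OF indep_step]]) auto
  have prod: "(\<Prod>i<n. exp (- (l * step i \<omega>))) = exp (- (l * \<tau> n \<omega>))" if "\<omega> \<in> space M" for \<omega>
    using that by (simp add: \<tau>_eq_sum exp_sum[symmetric] sum_negf sum_distrib_left)
  have int: "integrable M (\<lambda>\<omega>. exp (- (l * \<tau> n \<omega>)))"
    using indep_vars_integrable[OF _ ind exp_step] prod
    by (subst Bochner_Integration.integrable_cong[OF refl prod[symmetric]]) auto
  have "expectation (\<lambda>\<omega>. exp (- (l * \<tau> n \<omega>))) = expectation (\<lambda>\<omega>. \<Prod>i<n. exp (- (l * step i \<omega>)))"
    by (rule Bochner_Integration.integral_cong) (simp_all add: prod)
  also have "\<dots> = (\<Prod>i<n. expectation (\<lambda>\<omega>. exp (- (l * step i \<omega>))))"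
    using ind exp_step by (intro indep_vars_lebesgue_integral) auto
  also have "\<dots> = (\<Prod>i<n. expectation (\<lambda>\<omega>. exp (- (l * \<tau> 1 \<omega>))))"
    by (intro prod.cong refl expectation_step[of "\<lambda>x. exp (- (l * x))"]) auto
  also have "\<dots> \<le> (\<Prod>i<n. exp (- (1 / (4 * B))))"
    using 1 by (intro prod_mono) auto
  also have "\<dots> = exp (- (real n / (4 * B)))"
    by (simp add: exp_of_nat_mult[symmetric])
  finally have 2: "expectation (\<lambda>\<omega>. exp (- (l * \<tau> n \<omega>))) \<le> exp (- (real n / (4 * B)))" .
  have "prob {\<omega> \<in> space M. \<tau> n \<omega> \<le> t} = prob {\<omega> \<in> space M. exp (- (l * t)) \<le> exp (- (l * \<tau> n \<omega>))}"
    using l by simp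
  also have "\<dots> \<le> expectation (\<lambda>\<omega>. exp (- (l * \<tau> n \<omega>))) / exp (- (l * t))"
    using int by (intro integral_Markov_inequality_measure[where A = "{}"]) auto
  also have "\<dots> \<le> exp (- (real n / (4 * B))) / exp (- (l * t))"
    using 2 by (intro divide_right_mono) auto
  also have "\<dots> = exp (t / (2 * B * \<delta>) - real n / (4 * B))"
    by (simp add: exp_diff[symmetric] l_def)
  finally show ?thesis .
qed

text \<open>Borel-Cantelli, as the bounds of \<open>prob_le_exp\<close> are geometric in
  \<open>n\<close>. Almost surely \<open>Max\<close> in \<open>renewal_count\<close> is therefore a
  genuine maximum.\<close>

lemma AE_finite_renewals: "AE \<omega> in M. finite {n. \<tau> n \<omega> \<le> t}"
proof -
  let ?q = "exp (- (1 / (4 * B)))"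
  have eq: "exp (t / (2 * B * \<delta>) - real n / (4 * B)) = exp (t / (2 * B * \<delta>)) * ?q ^ n" for n
    by (simp add: exp_diff exp_minus power_divide exp_of_nat_mult[symmetric] field_simps)
  have "summable (\<lambda>n. exp (t / (2 * B * \<delta>)) * ?q ^ n)"
    using B_pos by (intro summable_mult summable_geometric) auto
  then have "summable (\<lambda>n. prob {\<omega> \<in> space M. \<tau> n \<omega> \<le> t})"
    by (rule summable_comparison_test'[where N = 0]) (use prob_le_exp[of _ t] eq in auto)
  then have "AE \<omega> in M. \<forall>\<^sub>F n in sequentially. \<omega> \<in> space M - {\<omega> \<in> space M. \<tau> n \<omega> \<le> t}"
    by (intro borel_cantelli_AE1) (auto simp: emeasure_eq_measure)
  then show ?thesis
  proof (rule AE_mp, intro AE_I2 impI)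
    fix \<omega> assume "\<forall>\<^sub>F n in sequentially. \<omega> \<in> space M - {\<omega> \<in> space M. \<tau> n \<omega> \<le> t}" "\<omega> \<in> space M"
    then obtain m where "\<And>n. n \<ge> m \<Longrightarrow> \<not> \<tau> n \<omega> \<le> t"
      by (auto simp: eventually_sequentially)
    then have "{n. \<tau> n \<omega> \<le> t} \<subseteq> {..<m}" by (auto simp: not_le[symmetric])
    then show "finite {n. \<tau> n \<omega> \<le> t}" by (rule finite_subset) auto
  qed
qed

lemma renewal_count_measurable [measurable]:
  "renewal_count \<tau> t \<in> measurable M (count_space UNIV)"
  unfolding renewal_count_def[abs_def] by measurable

lemma renewal_count_bounds:
  assumes "finite {n. \<tau> n \<omega> \<le> t}" "\<omega> \<in> space M" "0 \<le> t"
  shows "\<tau> (renewal_count \<tau> t \<omega>) \<omega> \<le> t" "t < \<tau> (Suc (renewal_count \<tau> t \<omega>)) \<omega>"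
proof -
  have "0 \<in> {n. \<tau> n \<omega> \<le> t}" using assms by (simp add: \<tau>_eq_sum)
  then have "renewal_count \<tau> t \<omega> \<in> {n. \<tau> n \<omega> \<le> t}"
    unfolding renewal_count_def using assms(1) by (intro Max_in) auto
  then show "\<tau> (renewal_count \<tau> t \<omega>) \<omega> \<le> t" by simp
  have "n \<le> renewal_count \<tau> t \<omega>" if "\<tau> n \<omega> \<le> t" for n
    unfolding renewal_count_def using assms(1) that by (intro Max_ge) auto
  from this[of "Suc (renewal_count \<tau> t \<omega>)"] show "t < \<tau> (Suc (renewal_count \<tau> t \<omega>)) \<omega>"
    by (auto simp: not_le[symmetric])
qed

lemma centered_steps:
  assumes "p \<ge> 2" "integrable M (\<lambda>\<omega>. \<bar>\<tau> 1 \<omega> - \<delta>\<bar> powr p)"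
    and "expectation (\<lambda>\<omega>. \<bar>\<tau> 1 \<omega> - \<delta>\<bar> powr p) \<le> \<beta>"
  shows "centered_steps M (\<lambda>i \<omega>. step i \<omega> - \<delta>) p \<beta>"
proof
  show "indep_vars (\<lambda>_. borel) (\<lambda>i \<omega>. step i \<omega> - \<delta>) UNIV"
    by (rule indep_vars_compose2[OF indep_step]) auto
  show "integrable M (\<lambda>\<omega>. step i \<omega> - \<delta>)" for i
    using integrable_step_iff[of "\<lambda>x. x" i] mean_int by simp
  then show "expectation (\<lambda>\<omega>. step i \<omega> - \<delta>) = 0" for i
    using expectation_step[of "\<lambda>x. x - \<delta>" i] mean_int mean by (simp add: prob_space)
  show "integrable M (\<lambda>\<omega>. \<bar>step i \<omega> - \<delta>\<bar> powr p)" for i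
    using integrable_step_iff[of "\<lambda>x. \<bar>x - \<delta>\<bar> powr p" i] assms by simp
  show "expectation (\<lambda>\<omega>. \<bar>step i \<omega> - \<delta>\<bar> powr p) \<le> \<beta>" for i
    using expectation_step[of "\<lambda>x. \<bar>x - \<delta>\<bar> powr p" i] assms by simp
qed fact

text \<open>On the event \<open>N \<ge> L\<close> the series dominates \<open>real N powr r\<close>,
  which is its term at \<open>n = N\<close>; the law of the count is thus avoided. For
  \<open>n \<ge> 4 * t / \<delta>\<close> the positive Chernoff exponent
  \<open>t / (2 * B * \<delta>)\<close> is at most \<open>n / (8 * B)\<close>.\<close>

lemma nn_integral_tail_le:
  assumes "real L \<ge> 4 * t / \<delta>"
  shows "(\<integral>\<^sup>+\<omega>. (\<Sum>n. ennreal (real n powr r * indicator {\<omega> \<in> space M. L \<le> n \<and> \<tau> n \<omega> \<le> t} \<omega>)) \<partial>M)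
    \<le> ennreal (exp_series B r)"
proof -
  have "(\<integral>\<^sup>+\<omega>. ennreal (real n powr r * indicator {\<omega> \<in> space M. L \<le> n \<and> \<tau> n \<omega> \<le> t} \<omega>) \<partial>M)
    \<le> ennreal (real n powr r * exp (- (real n / (8 * B))))" for n
  proof -
    have "(\<integral>\<^sup>+\<omega>. ennreal (real n powr r * indicator {\<omega> \<in> space M. L \<le> n \<and> \<tau> n \<omega> \<le> t} \<omega>) \<partial>M)
      = ennreal (real n powr r * prob {\<omega> \<in> space M. L \<le> n \<and> \<tau> n \<omega> \<le> t})"
      by (subst nn_integral_eq_integral)
        (auto intro!: integrable_mult_right integrable_real_indicator simp: emeasure_eq_measure)
    also have "\<dots> \<le> ennreal (real n powr r * exp (- (real n / (8 * B))))"
    proof (intro ennreal_leI mult_left_mono)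
      show "prob {\<omega> \<in> space M. L \<le> n \<and> \<tau> n \<omega> \<le> t} \<le> exp (- (real n / (8 * B)))"
      proof (cases "L \<le> n")
        case True
        have "prob {\<omega> \<in> space M. \<tau> n \<omega> \<le> t} \<le> exp (t / (2 * B * \<delta>) - real n / (4 * B))"
          by (rule prob_le_exp)
        also have "\<dots> \<le> exp (- (real n / (8 * B)))"
        proof -
          have "4 * t / \<delta> \<le> real n" using True assms by simp
          then have "4 * t / \<delta> / (8 * B) \<le> real n / (8 * B)"
            using B_pos by (intro divide_right_mono) auto
          moreover have "4 * t / \<delta> / (8 * B) = t / (2 * B * \<delta>)" by simp
          moreover have "real n / (4 * B) = 2 * (real n / (8 * B))" by simp
          ultimately show ?thesis by simp
        qed
        finally show ?thesis using True by simp
      qed simp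
    qed simp
    finally show ?thesis .
  qed
  then have "(\<Sum>n. \<integral>\<^sup>+\<omega>. ennreal (real n powr r * indicator {\<omega> \<in> space M. L \<le> n \<and> \<tau> n \<omega> \<le> t} \<omega>) \<partial>M)
     \<le> (\<Sum>n. ennreal (real n powr r * exp (- (real n / (8 * B)))))"
    by (intro suminf_le) auto
  also have "\<dots> = ennreal (exp_series B r)"
    unfolding exp_series_def using B_pos by (intro suminf_ennreal2 summable_exp_series) auto
  finally show ?thesis by (subst nn_integral_suminf) auto
qed

text \<open>The quantitative core for a fixed law. Since \<open>C\<close> is built from
  \<open>r\<close>, \<open>p = max r 2\<close> and \<open>B\<close> alone, the bound is uniform
  along the joint limit.\<close>

lemma renewal_moment:
  assumes r: "r \<ge> 1" and t: "\<delta> \<le> t" and \<beta>: "0 < \<beta>"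
    and p: "p = max r 2" "integrable M (\<lambda>\<omega>. \<bar>\<tau> 1 \<omega> - \<delta>\<bar> powr p)"
      "expectation (\<lambda>\<omega>. \<bar>\<tau> 1 \<omega> - \<delta>\<bar> powr p) \<le> \<beta>"
  defines "C \<equiv> 2 powr r * (1 + 4 * (8 * p) powr p * 6 powr (p / 2)) + exp_series B r"
  shows "integrable M (\<lambda>\<omega>. \<bar>\<delta> * real (renewal_count \<tau> t \<omega>) / t - 1\<bar> powr r)" (is ?int)
    and "expectation (\<lambda>\<omega>. \<bar>\<delta> * real (renewal_count \<tau> t \<omega>) / t - 1\<bar> powr r)
      \<le> C * ((\<delta> / t) powr r + (\<beta> powr (2 / p) / (\<delta> * t)) powr (r / 2))" (is ?le)
proof -
  have tp: "0 < t" using t \<delta>_pos by simp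
  have p2: "2 \<le> p" "r \<le> p" using p by auto
  interpret centered_steps M "\<lambda>i \<omega>. step i \<omega> - \<delta>" p \<beta>
    using centered_steps p2(1) p(2,3) .
  have walk_eq: "walk n \<omega> = \<tau> n \<omega> - real n * \<delta>" if "\<omega> \<in> space M" for n \<omega>
    using that by (simp add: walk_def \<tau>_eq_sum sum_subtractf)
  \<comment> \<open>Rounding up and adding 1 cost at most 2, which is at most
    \<open>2 * (t / \<delta>)\<close> because \<open>\<delta> \<le> t\<close>; hence the factor
    6.\<close>
  define L where "L = nat \<lceil>4 * t / \<delta>\<rceil> + 1"
  have "0 \<le> 4 * t / \<delta>" "1 \<le> t / \<delta>" using tp \<delta>_pos t by auto
  then have L: "4 * t / \<delta> \<le> real L" "real L \<le> 6 * (t / \<delta>)"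
    by (auto simp: L_def) linarith+
  let ?K = "4 * (8 * p) powr p * 6 powr (p / 2)"
  \<comment> \<open>The size of the fluctuations over about \<open>t / \<delta>\<close> steps: the
    maximal inequality bounds the \<open>p\<close>-th moment of \<open>?S\<close> by
    \<open>?K * s powr p\<close>, and \<open>s / t\<close> yields the second error term.\<close>
  define s where "s = sqrt (t / \<delta>) * \<beta> powr (1 / p)"
  have s: "0 < s" using tp \<delta>_pos \<beta> by (simp add: s_def)
  have s_powr: "s powr p = (t / \<delta>) powr (p / 2) * \<beta>"
    using tp \<delta>_pos \<beta> p2 by (simp add: s_def powr_mult powr_powr powr_half_sqrt[symmetric])
  let ?S = "sup_walk L"
  have "expectation (\<lambda>\<omega>. ?S \<omega> powr p) \<le> 4 * (8 * p) powr p * real L powr (p / 2) * \<beta>"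
    by (rule expectation_sup_walk_powr_le)
  also have "\<dots> \<le> 4 * (8 * p) powr p * (6 * (t / \<delta>)) powr (p / 2) * \<beta>"
    using p2 \<beta> L by (intro mult_right_mono mult_left_mono powr_mono2) auto
  also have "\<dots> = ?K * s powr p"
    using tp \<delta>_pos by (simp only: powr_mult s_powr mult.assoc)
  finally have S_le: "expectation (\<lambda>\<omega>. ?S \<omega> powr p) / s powr p \<le> ?K"
    using s by (simp add: pos_divide_le_eq)
  have base: "(s / t) powr r = (\<beta> powr (2 / p) / (\<delta> * t)) powr (r / 2)"
  proof -
    have "(s / t)\<^sup>2 = \<beta> powr (2 / p) / (\<delta> * t)"
    proof -
      have "(\<beta> powr (1 / p))\<^sup>2 = \<beta> powr (2 / p)"
        using \<beta> by (simp add: powr_powr powr_numeral[symmetric] del: powr_numeral)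
      then have "(s / t)\<^sup>2 = (t / \<delta>) * \<beta> powr (2 / p) / t\<^sup>2" using tp \<delta>_pos
        by (simp only: s_def power_divide power_mult_distrib) simp
      then show ?thesis using tp \<delta>_pos by (simp add: power2_eq_square field_simps)
    qed
    then have "(\<beta> powr (2 / p) / (\<delta> * t)) powr (r / 2) = ((s / t) powr 2) powr (r / 2)"
      using s tp by simp
    also have "\<dots> = (s / t) powr r" by (simp only: powr_powr) simp
    finally show ?thesis by simp
  qed
  \<comment> \<open>The exponent \<open>r\<close> is raised to \<open>p\<close>, which matters for
    \<open>r < 2\<close>. Dividing by \<open>s\<close> beforehand keeps the additional 1 on the
    correct scale.\<close>
  define F where "F \<omega> = 2 powr r * ((\<delta> / t) powr r + (s / t) powr r * (1 + ?S \<omega> powr p / s powr p))" for \<omega>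
  have F_nonneg: "0 \<le> F \<omega>" for \<omega> by (simp add: F_def)
  have F_int: "integrable M F" unfolding F_def using sup_walk_powr_int by simp
  have "expectation F = 2 powr r * ((\<delta> / t) powr r + (s / t) powr r * (1 + expectation (\<lambda>\<omega>. ?S \<omega> powr p) / s powr p))"
    unfolding F_def using sup_walk_powr_int by (simp add: prob_space)
  also have "\<dots> \<le> 2 powr r * ((\<delta> / t) powr r + (s / t) powr r * (1 + ?K))"
    using S_le by (intro mult_left_mono add_mono) auto
  finally have EF: "expectation F \<le> 2 powr r * ((\<delta> / t) powr r + (s / t) powr r * (1 + ?K))" .
  define w where "w n \<omega> = ennreal (real n powr r * indicator {\<omega> \<in> space M. L \<le> n \<and> \<tau> n \<omega> \<le> t} \<omega>)" for n \<omega>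
  define W where "W \<omega> = (\<Sum>n. w n \<omega>)" for \<omega>
  have [measurable]: "W \<in> borel_measurable M" unfolding W_def[abs_def] w_def[abs_def] by measurable
  have W_le: "(\<integral>\<^sup>+\<omega>. W \<omega> \<partial>M) \<le> ennreal (exp_series B r)"
    unfolding W_def w_def using L(1) by (rule nn_integral_tail_le)
  let ?N = "\<lambda>\<omega>. renewal_count \<tau> t \<omega>"
  let ?D = "\<lambda>\<omega>. \<bar>\<delta> * real (renewal_count \<tau> t \<omega>) / t - 1\<bar> powr r"
  have pointwise: "ennreal (?D \<omega>) \<le> ennreal (F \<omega>) + ennreal ((\<delta> / t) powr r) * W \<omega>"
    if fin: "finite {n. \<tau> n \<omega> \<le> t}" and \<omega>: "\<omega> \<in> space M" for \<omega>
  proof (cases "Suc (?N \<omega>) \<le> L")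
    case True
    note b = renewal_count_bounds[OF fin \<omega>]
    \<comment> \<open>Index \<open>N\<close> controls \<open>\<delta> * N - t\<close> from above and
      index \<open>N + 1\<close> controls it from below. The shift by one index produces the summand
      \<delta> and is the reason for demanding \<open>N + 1 \<le> L\<close>.\<close>
    have "\<bar>walk (?N \<omega>) \<omega>\<bar> \<le> ?S \<omega>" "\<bar>walk (Suc (?N \<omega>)) \<omega>\<bar> \<le> ?S \<omega>"
      using True by (intro abs_walk_le_sup_walk; simp)+
    then have "\<bar>\<delta> * real (?N \<omega>) - t\<bar> \<le> \<delta> + ?S \<omega>"
      using b tp \<delta>_pos by (simp add: walk_eq[OF \<omega>] abs_le_iff algebra_simps)
    then have "\<bar>\<delta> * real (?N \<omega>) - t\<bar> / t \<le> (\<delta> + ?S \<omega>) / t"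
      using tp by (intro divide_right_mono) auto
    moreover have "\<delta> * real (?N \<omega>) / t - 1 = (\<delta> * real (?N \<omega>) - t) / t"
      using tp by (simp add: diff_divide_distrib)
    ultimately have "\<bar>\<delta> * real (?N \<omega>) / t - 1\<bar> \<le> (\<delta> + ?S \<omega>) / t"
      using tp by (simp only: abs_divide abs_of_pos)
    then have "?D \<omega> \<le> \<bar>\<delta> / t + ?S \<omega> / t\<bar> powr r"
      using r tp \<delta>_pos by (intro powr_mono2) (auto simp: add_divide_distrib)
    also have "\<dots> \<le> 2 powr r * (\<bar>\<delta> / t\<bar> powr r + \<bar>?S \<omega> / t\<bar> powr r)"
      using r by (intro powr_abs_add_le_two) auto
    also have "\<dots> = 2 powr r * ((\<delta> / t) powr r + (s / t * (?S \<omega> / s)) powr r)"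
      using tp \<delta>_pos s by (simp add: sup_walk_nonneg)
    also have "\<dots> \<le> F \<omega>"
    proof -
      have "(s / t * (?S \<omega> / s)) powr r = (s / t) powr r * (?S \<omega> / s) powr r" by (rule powr_mult)
      also have "\<dots> \<le> (s / t) powr r * (1 + (?S \<omega> / s) powr p)"
        using r p2 s sup_walk_nonneg by (intro mult_left_mono powr_le_add_powr) auto
      finally show ?thesis by (simp add: F_def powr_divide)
    qed
    finally have "ennreal (?D \<omega>) \<le> ennreal (F \<omega>)" by (rule ennreal_leI)
    then show ?thesis by (simp add: add_increasing2)
  next
    case False
    then have N: "L \<le> ?N \<omega>" by simp
    have "4 * (t / \<delta>) \<le> real (?N \<omega>)" using N L by simp
    then have "t / \<delta> \<le> real (?N \<omega>)" using \<open>1 \<le> t / \<delta>\<close> by linarith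
    \<comment> \<open>With the quotient at least 1, its distance to 1 is at most the quotient
      itself.\<close>
    then have "1 \<le> \<delta> * real (?N \<omega>) / t" using tp \<delta>_pos by (simp add: field_simps)
    then have "?D \<omega> \<le> (\<delta> / t * real (?N \<omega>)) powr r"
      using r by (intro powr_mono2) auto
    also have "\<dots> = (\<delta> / t) powr r * real (?N \<omega>) powr r" by (rule powr_mult)
    finally have "ennreal (?D \<omega>) \<le> ennreal ((\<delta> / t) powr r) * ennreal (real (?N \<omega>) powr r)"
      by (simp add: ennreal_mult[symmetric] ennreal_leI)
    also have "\<dots> \<le> ennreal ((\<delta> / t) powr r) * W \<omega>"
    proof (rule mult_left_mono)
      have "ennreal (real (?N \<omega>) powr r) = w (?N \<omega>) \<omega>"
        using renewal_count_bounds(1)[OF fin \<omega>] tp N \<omega> by (simp add: w_def)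
      also have "\<dots> \<le> W \<omega>"
        using sum_le_suminf[of "\<lambda>n. w n \<omega>" "{?N \<omega>}"] by (simp add: W_def)
      finally show "ennreal (real (?N \<omega>) powr r) \<le> W \<omega>" .
    qed simp
    finally show ?thesis by (simp add: add_increasing)
  qed
  have A: "0 \<le> exp_series B r"
    unfolding exp_series_def using B_pos by (intro suminf_nonneg summable_exp_series) auto
  have "(\<integral>\<^sup>+\<omega>. ennreal (?D \<omega>) \<partial>M) \<le> (\<integral>\<^sup>+\<omega>. ennreal (F \<omega>) + ennreal ((\<delta> / t) powr r) * W \<omega> \<partial>M)"
    using AE_finite_renewals[of t] by (intro nn_integral_mono_AE) (auto intro: pointwise)
  also have "\<dots> = ennreal (expectation F) + ennreal ((\<delta> / t) powr r) * (\<integral>\<^sup>+\<omega>. W \<omega> \<partial>M)"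
  proof -
    have [measurable]: "F \<in> borel_measurable M" using F_int by (rule borel_measurable_integrable)
    show ?thesis
      using F_int F_nonneg by (simp add: nn_integral_add nn_integral_cmult nn_integral_eq_integral)
  qed
  also have "\<dots> \<le> ennreal (expectation F) + ennreal ((\<delta> / t) powr r) * ennreal (exp_series B r)"
    by (intro add_left_mono mult_left_mono W_le) simp
  also have "\<dots> = ennreal (expectation F + (\<delta> / t) powr r * exp_series B r)"
    using A F_nonneg by (simp add: ennreal_mult[symmetric] ennreal_plus[symmetric] del: ennreal_plus)
  also have "\<dots> \<le> ennreal (C * ((\<delta> / t) powr r + (s / t) powr r))"
  proof (rule ennreal_leI)
    let ?a = "(\<delta> / t) powr r" and ?b = "(s / t) powr r" and ?c = "2 powr r :: real"
    have "0 \<le> ?c * ?K * ?a" "0 \<le> exp_series B r * ?b" using A by simp_all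
    moreover have "C * (?a + ?b) = ?c * (?a + ?b * (1 + ?K)) + ?a * exp_series B r + ?c * ?K * ?a + exp_series B r * ?b"
      unfolding C_def by (simp add: algebra_simps)
    ultimately show "expectation F + ?a * exp_series B r \<le> C * (?a + ?b)"
      using EF by linarith
  qed
  finally have *: "(\<integral>\<^sup>+\<omega>. ennreal (?D \<omega>) \<partial>M) \<le> ennreal (C * ((\<delta> / t) powr r + (s / t) powr r))" .
  show ?int
    by (rule integrableI_nonneg) (use * in \<open>auto simp: le_less_trans\<close>)
  have "0 \<le> C" using A by (simp add: C_def)
  then have "expectation ?D \<le> C * ((\<delta> / t) powr r + (s / t) powr r)"
    using * by (intro integral_real_bounded) auto
  then show ?le by (simp only: base)
qed

end

section \<open>The joint limit\<close>

lemma filterlim_joint_limit: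
  shows joint_limit_fst: "filterlim fst (to_infinity_along D) (joint_limit D)"
    and joint_limit_snd: "filterlim snd at_top (joint_limit D)"
    and joint_limit_ratio: "((\<lambda>(\<delta>, t). \<delta> / t) \<longlongrightarrow> 0) (joint_limit D)"
  unfolding joint_limit_def
  by (rule filterlim_mono[OF filterlim_filtercomap order_refl]; simp add: le_infI1 le_infI2)+

text \<open>The ratio tends to 0 and is therefore eventually below 1, which with
  \<open>t > 0\<close> gives the condition \<open>\<delta> \<le> t\<close> of
  \<open>renewal_moment\<close>.\<close>

lemma eventually_joint_limit:
  assumes "D \<subseteq> {0<..}" "\<forall>\<^sub>F \<delta> in to_infinity_along D. P \<delta>"
  shows "\<forall>\<^sub>F (\<delta>, t) in joint_limit D. \<delta> \<in> D \<and> 0 < \<delta> \<and> \<delta> \<le> t \<and> P \<delta>"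
proof -
  have "\<forall>\<^sub>F \<delta> in to_infinity_along D. \<delta> \<in> D \<and> P \<delta>"
    using assms(2) by (auto simp: to_infinity_along_def eventually_inf_principal)
  then have 1: "\<forall>\<^sub>F x in joint_limit D. fst x \<in> D \<and> P (fst x)"
    using joint_limit_fst by (rule eventually_compose_filterlim)
  have 2: "\<forall>\<^sub>F x in joint_limit D. snd x > 0"
    using eventually_gt_at_top joint_limit_snd by (rule eventually_compose_filterlim)
  have 3: "\<forall>\<^sub>F x in joint_limit D. (case x of (\<delta>, t) \<Rightarrow> \<delta> / t) < 1"
    using joint_limit_ratio by (rule order_tendstoD) simp
  show ?thesis
    using 1 2 3 by eventually_elim (use assms(1) in \<open>auto simp: field_simps\<close>)
qed

text \<open>Exponents are compared for the rescaled variable \<open>X \<omega> / \<delta>\<close>,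
  so that the additive 1 becomes a multiple of \<open>\<delta> powr s\<close>.\<close>

lemma (in prob_space) lower_moment_le:
  fixes X :: "'a \<Rightarrow> real"
  assumes [measurable]: "X \<in> borel_measurable M"
    and nonneg: "AE \<omega> in M. 0 \<le> X \<omega>" and "0 < \<delta>" "0 \<le> s" "s \<le> q"
    and int: "integrable M (\<lambda>\<omega>. X \<omega> powr q)"
    and le: "expectation (\<lambda>\<omega>. X \<omega> powr q) \<le> K * \<delta> powr q"
  shows "integrable M (\<lambda>\<omega>. X \<omega> powr s)" (is ?int)
    and "expectation (\<lambda>\<omega>. X \<omega> powr s) \<le> (1 + K) * \<delta> powr s" (is ?le)
proof -
  have bound: "AE \<omega> in M. X \<omega> powr s \<le> \<delta> powr s * (1 + X \<omega> powr q / \<delta> powr q)"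
    using nonneg
  proof (rule AE_mp, intro AE_I2 impI)
    fix \<omega> assume "0 \<le> X \<omega>"
    have "X \<omega> powr s = (\<delta> * (X \<omega> / \<delta>)) powr s" using assms by simp
    also have "\<dots> = \<delta> powr s * (X \<omega> / \<delta>) powr s" by (rule powr_mult)
    also have "\<dots> \<le> \<delta> powr s * (1 + (X \<omega> / \<delta>) powr q)"
      using assms \<open>0 \<le> X \<omega>\<close> by (intro mult_left_mono powr_le_add_powr) auto
    finally show "X \<omega> powr s \<le> \<delta> powr s * (1 + X \<omega> powr q / \<delta> powr q)" by (simp add: powr_divide)
  qed
  have int': "integrable M (\<lambda>\<omega>. \<delta> powr s * (1 + X \<omega> powr q / \<delta> powr q))" using int by simp
  then show ?int
    by (rule Bochner_Integration.integrable_bound) (use bound in \<open>auto simp: abs_mult\<close>)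
  then have "expectation (\<lambda>\<omega>. X \<omega> powr s) \<le> expectation (\<lambda>\<omega>. \<delta> powr s * (1 + X \<omega> powr q / \<delta> powr q))"
    using int' bound by (rule integral_mono_AE)
  also have "\<dots> = \<delta> powr s * (1 + expectation (\<lambda>\<omega>. X \<omega> powr q) / \<delta> powr q)"
    using int by (simp add: prob_space)
  also have "\<dots> \<le> \<delta> powr s * (1 + K)"
    using le \<open>0 < \<delta>\<close> by (intro mult_left_mono add_left_mono) (auto simp: field_simps)
  finally show ?le by (simp add: mult_ac)
qed

text \<open>Converts the raw moment hypothesis into a centred moment of the natural order
  \<open>\<delta> powr p\<close>, as needed for convergence in the mean of order
  \<open>r\<close>.\<close>

lemma (in prob_space) centered_moment_le:
  fixes X :: "'a \<Rightarrow> real"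
  assumes [measurable]: "X \<in> borel_measurable M"
    and nonneg: "AE \<omega> in M. 0 \<le> X \<omega>" and "0 < \<delta>" "0 \<le> p" "p \<le> q"
    and int: "integrable M (\<lambda>\<omega>. X \<omega> powr q)"
    and le: "expectation (\<lambda>\<omega>. X \<omega> powr q) \<le> K * \<delta> powr q"
  shows "integrable M (\<lambda>\<omega>. \<bar>X \<omega> - \<delta>\<bar> powr p)" (is ?int)
    and "expectation (\<lambda>\<omega>. \<bar>X \<omega> - \<delta>\<bar> powr p) \<le> 2 powr p * (2 + K) * \<delta> powr p" (is ?le)
proof -
  note X = lower_moment_le[OF assms]
  have bound: "AE \<omega> in M. \<bar>X \<omega> - \<delta>\<bar> powr p \<le> 2 powr p * (X \<omega> powr p + \<delta> powr p)"
    using nonneg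
  proof (rule AE_mp, intro AE_I2 impI)
    fix \<omega> assume "0 \<le> X \<omega>"
    then show "\<bar>X \<omega> - \<delta>\<bar> powr p \<le> 2 powr p * (X \<omega> powr p + \<delta> powr p)"
      using powr_abs_add_le_two[OF \<open>0 \<le> p\<close>, of "X \<omega>" "- \<delta>"] \<open>0 < \<delta>\<close> by simp
  qed
  have int': "integrable M (\<lambda>\<omega>. 2 powr p * (X \<omega> powr p + \<delta> powr p))" using X(1) by simp
  then show ?int
    by (rule Bochner_Integration.integrable_bound) (use bound in \<open>auto simp: abs_mult\<close>)
  then have "expectation (\<lambda>\<omega>. \<bar>X \<omega> - \<delta>\<bar> powr p) \<le> expectation (\<lambda>\<omega>. 2 powr p * (X \<omega> powr p + \<delta> powr p))"
    using int' bound by (rule integral_mono_AE)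
  also have "\<dots> = 2 powr p * (expectation (\<lambda>\<omega>. X \<omega> powr p) + \<delta> powr p)"
    using X(1) by (simp add: prob_space)
  also have "\<dots> \<le> 2 powr p * ((1 + K) * \<delta> powr p + \<delta> powr p)"
    using X(2) by (intro mult_left_mono add_right_mono) auto
  finally show ?le by (simp add: algebra_simps)
qed

text \<open>The ratio of \<open>E\<close> to the sum of powers is at most \<open>C\<close>; its
  roots of order \<open>r\<close> and \<open>r / 2\<close> are placed inside the two powers.
  Positivity of \<open>a\<close> and \<open>b\<close> keeps the denominator nonzero. This passes
  from an upper bound to the exact equality that a sum of powers of \<open>O\<close>-terms
  denotes.\<close>

lemma split_sum_bigo:
  fixes E a b :: "'i \<Rightarrow> real"
  assumes r: "r > 0" and C: "C \<ge> 0"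
    and ev: "\<forall>\<^sub>F x in F. 0 < a x \<and> 0 < b x \<and> 0 \<le> E x \<and> E x \<le> C * (a x powr r + b x powr (r / 2))"
  shows "\<exists>u v. u \<in> O[F](a) \<and> v \<in> O[F](b) \<and>
    (\<forall>\<^sub>F x in F. 0 \<le> u x \<and> 0 \<le> v x \<and> E x = u x powr r + v x powr (r / 2))"
proof -
  define c where "c x = E x / (a x powr r + b x powr (r / 2))" for x
  define u where "u x = c x powr (1 / r) * a x" for x
  define v where "v x = c x powr (2 / r) * b x" for x
  have c: "\<forall>\<^sub>F x in F. 0 < a x \<and> 0 < b x \<and> 0 \<le> c x \<and> c x \<le> C \<and> E x = c x * (a x powr r + b x powr (r / 2))"
    using ev
  proof eventually_elim
    case (elim x)
    then have "0 < a x powr r + b x powr (r / 2)" by (intro add_pos_pos) auto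
    then show ?case using elim by (auto simp: c_def pos_divide_le_eq)
  qed
  show ?thesis
  proof (intro exI conjI)
    show "u \<in> O[F](a)"
    proof (rule bigoI)
      show "\<forall>\<^sub>F x in F. norm (u x) \<le> C powr (1 / r) * norm (a x)"
        using c by eventually_elim (use r in \<open>auto simp: u_def abs_mult intro!: mult_right_mono powr_mono2\<close>)
    qed
    show "v \<in> O[F](b)"
    proof (rule bigoI)
      show "\<forall>\<^sub>F x in F. norm (v x) \<le> C powr (2 / r) * norm (b x)"
        using c by eventually_elim (use r in \<open>auto simp: v_def abs_mult intro!: mult_right_mono powr_mono2\<close>)
    qed
    show "\<forall>\<^sub>F x in F. 0 \<le> u x \<and> 0 \<le> v x \<and> E x = u x powr r + v x powr (r / 2)"
      using c
    proof eventually_elim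
      case (elim x)
      then show ?case using r by (simp add: u_def v_def powr_mult powr_powr algebra_simps)
    qed
  qed
qed

text \<open>Each \<open>O\<close>-term of the error is rendered by a nonnegative function,
  \<open>u\<close> or \<open>v\<close>, of that order, and the moment equals the sum of their
  powers. The moment conditions carry integrability explicitly, since otherwise the default value 0
  of the integral would satisfy them.\<close>

theorem theorem2p3:
  fixes D :: "real set"
    and M :: "real \<Rightarrow> 'a measure"
    and \<tau> :: "real \<Rightarrow> nat \<Rightarrow> 'a \<Rightarrow> real"
    and r :: real
  assumes D_pos: "D \<subseteq> {0<..}" and D_unbounded: "\<not> bdd_above D"
    and walk: "\<And>\<delta>. \<delta> \<in> D \<Longrightarrow> random_walk (M \<delta>) (\<tau> \<delta>)"
    and mean_int: "\<And>\<delta>. \<delta> \<in> D \<Longrightarrow> integrable (M \<delta>) (\<tau> \<delta> 1)"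
    and mean: "\<And>\<delta>. \<delta> \<in> D \<Longrightarrow> (\<integral>\<omega>. \<tau> \<delta> 1 \<omega> \<partial>M \<delta>) = \<delta>"
    and var_finite: "\<And>\<delta>. \<delta> \<in> D \<Longrightarrow> integrable (M \<delta>) (\<lambda>\<omega>. (\<tau> \<delta> 1 \<omega> - \<delta>)\<^sup>2)"
    and positive: "\<And>\<delta>. \<delta> \<in> D \<Longrightarrow> measure (M \<delta>) {\<omega> \<in> space (M \<delta>). \<tau> \<delta> 1 \<omega> > 0} = 1"
    and r: "r \<ge> 1"
    and moment_int: "\<forall>\<^sub>F \<delta> in to_infinity_along D.
           integrable (M \<delta>) (\<lambda>\<omega>. \<tau> \<delta> 1 \<omega> powr (r + 1))"
    and moment: "(\<lambda>\<delta>. \<integral>\<omega>. \<tau> \<delta> 1 \<omega> powr (r + 1) \<partial>M \<delta>)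
           \<in> O[to_infinity_along D](\<lambda>\<delta>. \<delta> powr (r + 1))"
  shows "tendsto_Lr r (\<lambda>(\<delta>, t). M \<delta>)
           (\<lambda>(\<delta>, t) \<omega>. \<delta> * real (renewal_count (\<tau> \<delta>) t \<omega>) / t) 1 (joint_limit D) \<and>
         (\<forall>q\<in>{0..max r 2}.
           (\<forall>\<^sub>F \<delta> in to_infinity_along D.
              integrable (M \<delta>) (\<lambda>\<omega>. \<bar>\<tau> \<delta> 1 \<omega> - \<delta>\<bar> powr max r 2)) \<longrightarrow>
           (\<lambda>\<delta>. \<integral>\<omega>. \<bar>\<tau> \<delta> 1 \<omega> - \<delta>\<bar> powr max r 2 \<partial>M \<delta>)
              \<in> O[to_infinity_along D](\<lambda>\<delta>. \<delta> powr q) \<longrightarrow>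
           (\<exists>u v. u \<in> O[joint_limit D](\<lambda>(\<delta>, t). \<delta> / t) \<and>
              v \<in> O[joint_limit D](\<lambda>(\<delta>, t). \<delta> powr (2 * q / max r 2 - 1) / t) \<and>
              (\<forall>\<^sub>F (\<delta>, t) in joint_limit D. 0 \<le> u (\<delta>, t) \<and> 0 \<le> v (\<delta>, t) \<and>
                 (\<integral>\<omega>. \<bar>\<delta> * real (renewal_count (\<tau> \<delta>) t \<omega>) / t - 1\<bar> powr r \<partial>M \<delta>)
                   = u (\<delta>, t) powr r + v (\<delta>, t) powr (r / 2))))"
proof -
  define p where "p = max r 2"
  have p: "2 \<le> p" "p \<le> r + 1" "0 < p" using r by (auto simp: p_def)
  let ?D = "\<lambda>\<delta> t \<omega>. \<bar>\<delta> * real (renewal_count (\<tau> \<delta>) t \<omega>) / t - 1\<bar> powr r"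
  let ?E = "\<lambda>\<delta> t. \<integral>\<omega>. ?D \<delta> t \<omega> \<partial>M \<delta>"
  have space: "prob_space (M \<delta>)" and meas: "\<tau> \<delta> n \<in> borel_measurable (M \<delta>)" if "\<delta> \<in> D" for \<delta> n
    using walk[OF that] by (auto simp: random_walk_def)
  have nonneg: "AE \<omega> in M \<delta>. 0 \<le> \<tau> \<delta> 1 \<omega>" if \<delta>: "\<delta> \<in> D" for \<delta>
  proof -
    interpret prob_space "M \<delta>" by (rule space[OF \<delta>])
    have [measurable]: "\<tau> \<delta> 1 \<in> borel_measurable (M \<delta>)" by (rule meas[OF \<delta>])
    have "{\<omega> \<in> space (M \<delta>). \<tau> \<delta> 1 \<omega> > 0} \<in> events" by measurable
    then have "AE \<omega> in M \<delta>. \<omega> \<in> {\<omega> \<in> space (M \<delta>). \<tau> \<delta> 1 \<omega> > 0}"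
      using positive[OF \<delta>] prob_eq_1 by blast
    then show ?thesis by (rule AE_mp) auto
  qed
  obtain K where K: "K > 0" "\<forall>\<^sub>F \<delta> in to_infinity_along D.
      (\<integral>\<omega>. \<tau> \<delta> 1 \<omega> powr (r + 1) \<partial>M \<delta>) \<le> K * \<delta> powr (r + 1)"
    using moment by (elim landau_o.bigE) (auto elim!: eventually_mono)
  define B where "B = 1 + K"
  have B: "B > 0" using K by (simp add: B_def)
  have moments: "\<forall>\<^sub>F \<delta> in to_infinity_along D. integrable (M \<delta>) (\<lambda>\<omega>. \<tau> \<delta> 1 \<omega> powr (r + 1))
      \<and> (\<integral>\<omega>. \<tau> \<delta> 1 \<omega> powr (r + 1) \<partial>M \<delta>) \<le> K * \<delta> powr (r + 1)"
    using moment_int K(2) by (rule eventually_conj)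
  have D_ev: "\<forall>\<^sub>F \<delta> in to_infinity_along D. \<delta> \<in> D"
    by (auto simp: to_infinity_along_def eventually_inf_principal)
  have renewal: "renewal_walk (M \<delta>) (\<tau> \<delta>) \<delta> B"
    if \<delta>: "\<delta> \<in> D" and int: "integrable (M \<delta>) (\<lambda>\<omega>. \<tau> \<delta> 1 \<omega> powr (r + 1))"
      and le: "(\<integral>\<omega>. \<tau> \<delta> 1 \<omega> powr (r + 1) \<partial>M \<delta>) \<le> K * \<delta> powr (r + 1)" for \<delta>
  proof
    interpret prob_space "M \<delta>" by (rule space[OF \<delta>])
    have \<delta>0: "0 < \<delta>" using \<delta> D_pos by auto
    have [measurable]: "\<tau> \<delta> (Suc 0) \<in> borel_measurable (M \<delta>)" by (rule meas[OF \<delta>])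
    have sq: "AE \<omega> in M \<delta>. \<tau> \<delta> 1 \<omega> powr 2 = (\<tau> \<delta> 1 \<omega>)\<^sup>2"
      using nonneg[OF \<delta>] by (rule AE_mp) auto
    note m2 = lower_moment_le[OF meas[OF \<delta>] nonneg[OF \<delta>] \<delta>0 _ _ int le, of 2]
    show "integrable (M \<delta>) (\<lambda>\<omega>. (\<tau> \<delta> 1 \<omega>)\<^sup>2)"
      using m2(1) r by (subst integrable_cong_AE[OF _ _ sq, symmetric]) auto
    show "(\<integral>\<omega>. (\<tau> \<delta> 1 \<omega>)\<^sup>2 \<partial>M \<delta>) \<le> B * \<delta>\<^sup>2"
      using m2(2) r \<delta>0 by (subst integral_cong_AE[OF _ _ sq, symmetric]) (auto simp: B_def)
  qed (use \<delta> D_pos walk mean_int mean nonneg B in auto)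
  \<comment> \<open>Both assertions come from this estimate, with \<open>q\<close> left free:
    \<open>q = p\<close> gives the convergence, the prescribed \<open>q\<close> gives the
    rate.\<close>
  have rate: "\<exists>C\<ge>0. \<forall>\<^sub>F (\<delta>, t) in joint_limit D. \<delta> \<in> D \<and> 0 < \<delta> \<and> \<delta> \<le> t \<and>
      (\<lambda>\<omega>. \<delta> * real (renewal_count (\<tau> \<delta>) t \<omega>) / t) \<in> borel_measurable (M \<delta>) \<and>
      integrable (M \<delta>) (?D \<delta> t) \<and>
      ?E \<delta> t \<le> C * ((\<delta> / t) powr r + (\<delta> powr (2 * q / p - 1) / t) powr (r / 2))"
    if L: "L > 0" and centered: "\<forall>\<^sub>F \<delta> in to_infinity_along D.
        integrable (M \<delta>) (\<lambda>\<omega>. \<bar>\<tau> \<delta> 1 \<omega> - \<delta>\<bar> powr p) \<and> (\<integral>\<omega>. \<bar>\<tau> \<delta> 1 \<omega> - \<delta>\<bar> powr p \<partial>M \<delta>) \<le> L * \<delta> powr q"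
    for L q :: real
  proof -
    let ?C = "2 powr r * (1 + 4 * (8 * p) powr p * 6 powr (p / 2)) + exp_series B r"
    have C: "0 \<le> ?C"
      unfolding exp_series_def using B by (intro add_nonneg_nonneg suminf_nonneg summable_exp_series) auto
    have "\<forall>\<^sub>F (\<delta>, t) in joint_limit D. \<delta> \<in> D \<and> 0 < \<delta> \<and> \<delta> \<le> t \<and>
      (\<lambda>\<omega>. \<delta> * real (renewal_count (\<tau> \<delta>) t \<omega>) / t) \<in> borel_measurable (M \<delta>) \<and>
      integrable (M \<delta>) (?D \<delta> t) \<and>
      ?E \<delta> t \<le> ?C * (1 + L powr (r / p)) * ((\<delta> / t) powr r + (\<delta> powr (2 * q / p - 1) / t) powr (r / 2))"
      using eventually_joint_limit[OF D_pos eventually_conj[OF moments centered]]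
    proof (rule eventually_mono, unfold split_paired_all prod.case, elim conjE)
      fix \<delta> t :: real
      assume \<delta>: "\<delta> \<in> D" "0 < \<delta>" "\<delta> \<le> t"
        and m: "integrable (M \<delta>) (\<lambda>\<omega>. \<tau> \<delta> 1 \<omega> powr (r + 1))"
          "(\<integral>\<omega>. \<tau> \<delta> 1 \<omega> powr (r + 1) \<partial>M \<delta>) \<le> K * \<delta> powr (r + 1)"
        and c: "integrable (M \<delta>) (\<lambda>\<omega>. \<bar>\<tau> \<delta> 1 \<omega> - \<delta>\<bar> powr p)"
          "(\<integral>\<omega>. \<bar>\<tau> \<delta> 1 \<omega> - \<delta>\<bar> powr p \<partial>M \<delta>) \<le> L * \<delta> powr q"
      interpret renewal_walk "M \<delta>" "\<tau> \<delta>" \<delta> B using renewal[OF \<delta>(1) m] .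
      have \<beta>: "0 < L * \<delta> powr q" using L \<delta> by simp
      note R = renewal_moment[OF r \<delta>(3) \<beta> p_def c]
      let ?a = "(\<delta> / t) powr r" and ?b = "(\<delta> powr (2 * q / p - 1) / t) powr (r / 2)"
      \<comment> \<open>The exponent in the rate arises here: \<open>2 * q / p\<close> from the root
        of the moment bound, and the subtracted 1 from the number of steps, of order
        \<open>t / \<delta>\<close>.\<close>
      have "(L * \<delta> powr q) powr (2 / p) / (\<delta> * t) = L powr (2 / p) * (\<delta> powr (2 * q / p - 1) / t)"
        using \<delta> L by (simp add: powr_mult powr_powr powr_diff mult_ac)
      then have "((L * \<delta> powr q) powr (2 / p) / (\<delta> * t)) powr (r / 2) = (L powr (2 / p)) powr (r / 2) * ?b"
        by (simp only: powr_mult)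
      also have "(L powr (2 / p)) powr (r / 2) = L powr (r / p)" by (simp add: powr_powr)
      finally have "?E \<delta> t \<le> ?C * (?a + L powr (r / p) * ?b)" using R(2) by simp
      also have "\<dots> \<le> ?C * ((1 + L powr (r / p)) * (?a + ?b))"
      proof (intro mult_left_mono C)
        have "0 \<le> L powr (r / p) * ?a" "0 \<le> ?b" by simp_all
        then show "?a + L powr (r / p) * ?b \<le> (1 + L powr (r / p)) * (?a + ?b)"
          by (simp add: algebra_simps)
      qed
      finally have "?E \<delta> t \<le> ?C * (1 + L powr (r / p)) * (?a + ?b)" by (simp only: mult.assoc)
      moreover have "(\<lambda>\<omega>. \<delta> * real (renewal_count (\<tau> \<delta>) t \<omega>) / t) \<in> borel_measurable (M \<delta>)"
        by measurable
      ultimately show "\<delta> \<in> D \<and> 0 < \<delta> \<and> \<delta> \<le> t \<and>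
        (\<lambda>\<omega>. \<delta> * real (renewal_count (\<tau> \<delta>) t \<omega>) / t) \<in> borel_measurable (M \<delta>) \<and>
        integrable (M \<delta>) (?D \<delta> t) \<and> ?E \<delta> t \<le> ?C * (1 + L powr (r / p)) * (?a + ?b)"
        using \<delta> R(1) by simp
    qed
    then show ?thesis using C by (intro exI[of _ "?C * (1 + L powr (r / p))"]) auto
  qed
  show ?thesis
  proof (intro conjI ballI impI)
    have "\<forall>\<^sub>F \<delta> in to_infinity_along D. integrable (M \<delta>) (\<lambda>\<omega>. \<bar>\<tau> \<delta> 1 \<omega> - \<delta>\<bar> powr p) \<and>
        (\<integral>\<omega>. \<bar>\<tau> \<delta> 1 \<omega> - \<delta>\<bar> powr p \<partial>M \<delta>) \<le> 2 powr p * (2 + K) * \<delta> powr p"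
      using moments D_ev
    proof eventually_elim
      case (elim \<delta>)
      interpret prob_space "M \<delta>" by (rule space) (use elim in simp)
      show ?case
        using centered_moment_le[of "\<tau> \<delta> 1" \<delta> p "r + 1" K] elim meas nonneg D_pos p by auto
    qed
    from rate[OF _ this] K(1) obtain C where C: "C \<ge> 0" "\<forall>\<^sub>F (\<delta>, t) in joint_limit D. \<delta> \<in> D \<and> 0 < \<delta> \<and> \<delta> \<le> t \<and>
      (\<lambda>\<omega>. \<delta> * real (renewal_count (\<tau> \<delta>) t \<omega>) / t) \<in> borel_measurable (M \<delta>) \<and>
      integrable (M \<delta>) (?D \<delta> t) \<and>
      ?E \<delta> t \<le> C * ((\<delta> / t) powr r + (\<delta> powr (2 * p / p - 1) / t) powr (r / 2))"
      by auto
    \<comment> \<open>For \<open>q = p\<close> the exponent \<open>2 * p / p - 1\<close> is 1, so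
      both error terms are positive powers of \<open>\<delta> / t\<close>.\<close>
    have "((\<lambda>x. C * ((case x of (\<delta>, t) \<Rightarrow> \<delta> / t) powr r + (case x of (\<delta>, t) \<Rightarrow> \<delta> / t) powr (r / 2)))
        \<longlongrightarrow> C * (0 + 0)) (joint_limit D)"
    proof (intro tendsto_mult tendsto_add tendsto_const)
      have nn: "\<forall>\<^sub>F x in joint_limit D. 0 \<le> (case x of (\<delta>, t) \<Rightarrow> \<delta> / t)"
        using C(2) by (rule eventually_mono) auto
      have "((\<lambda>x. (case x of (\<delta>, t) \<Rightarrow> \<delta> / t) powr s) \<longlongrightarrow> 0) (joint_limit D)" if "0 < s" for s
        using tendsto_powr'[OF joint_limit_ratio tendsto_const, of s D] nn that by auto
      from this[of r] this[of "r / 2"] r show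
        "((\<lambda>x. (case x of (\<delta>, t) \<Rightarrow> \<delta> / t) powr r) \<longlongrightarrow> 0) (joint_limit D)"
        "((\<lambda>x. (case x of (\<delta>, t) \<Rightarrow> \<delta> / t) powr (r / 2)) \<longlongrightarrow> 0) (joint_limit D)" by auto
    qed
    then have lim: "((\<lambda>x. C * ((case x of (\<delta>, t) \<Rightarrow> \<delta> / t) powr r + (case x of (\<delta>, t) \<Rightarrow> \<delta> / t) powr (r / 2)))
        \<longlongrightarrow> 0) (joint_limit D)" by simp
    have "((\<lambda>(\<delta>, t). ?E \<delta> t) \<longlongrightarrow> 0) (joint_limit D)"
    proof (rule tendsto_sandwich[OF _ _ tendsto_const lim])
      show "\<forall>\<^sub>F x in joint_limit D. 0 \<le> (case x of (\<delta>, t) \<Rightarrow> ?E \<delta> t)"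
        by (intro always_eventually) auto
      show "\<forall>\<^sub>F x in joint_limit D. (case x of (\<delta>, t) \<Rightarrow> ?E \<delta> t)
        \<le> C * ((case x of (\<delta>, t) \<Rightarrow> \<delta> / t) powr r + (case x of (\<delta>, t) \<Rightarrow> \<delta> / t) powr (r / 2))"
        using C(2) by (rule eventually_mono) (use p in auto)
    qed
    moreover have "\<forall>\<^sub>F (\<delta>, t) in joint_limit D.
      (\<lambda>\<omega>. \<delta> * real (renewal_count (\<tau> \<delta>) t \<omega>) / t) \<in> borel_measurable (M \<delta>) \<and> integrable (M \<delta>) (?D \<delta> t)"
      using C(2) by (rule eventually_mono) auto
    ultimately show "tendsto_Lr r (\<lambda>(\<delta>, t). M \<delta>)
           (\<lambda>(\<delta>, t) \<omega>. \<delta> * real (renewal_count (\<tau> \<delta>) t \<omega>) / t) 1 (joint_limit D)"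
      unfolding tendsto_Lr_def by (simp add: case_prod_unfold)
  next
    fix q assume "q \<in> {0..max r 2}"
      and int: "\<forall>\<^sub>F \<delta> in to_infinity_along D. integrable (M \<delta>) (\<lambda>\<omega>. \<bar>\<tau> \<delta> 1 \<omega> - \<delta>\<bar> powr max r 2)"
      and O: "(\<lambda>\<delta>. \<integral>\<omega>. \<bar>\<tau> \<delta> 1 \<omega> - \<delta>\<bar> powr max r 2 \<partial>M \<delta>) \<in> O[to_infinity_along D](\<lambda>\<delta>. \<delta> powr q)"
    from O obtain L where L: "L > 0" "\<forall>\<^sub>F \<delta> in to_infinity_along D.
        (\<integral>\<omega>. \<bar>\<tau> \<delta> 1 \<omega> - \<delta>\<bar> powr max r 2 \<partial>M \<delta>) \<le> L * \<delta> powr q"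
      by (elim landau_o.bigE) (auto elim!: eventually_mono)
    from rate[OF L(1) eventually_conj[OF int L(2), folded p_def]] obtain C where C: "C \<ge> 0"
      "\<forall>\<^sub>F (\<delta>, t) in joint_limit D. \<delta> \<in> D \<and> 0 < \<delta> \<and> \<delta> \<le> t \<and>
      (\<lambda>\<omega>. \<delta> * real (renewal_count (\<tau> \<delta>) t \<omega>) / t) \<in> borel_measurable (M \<delta>) \<and>
      integrable (M \<delta>) (?D \<delta> t) \<and>
      ?E \<delta> t \<le> C * ((\<delta> / t) powr r + (\<delta> powr (2 * q / p - 1) / t) powr (r / 2))"
      by blast
    have "\<exists>u v. u \<in> O[joint_limit D](\<lambda>(\<delta>, t). \<delta> / t) \<and>
        v \<in> O[joint_limit D](\<lambda>(\<delta>, t). \<delta> powr (2 * q / p - 1) / t) \<and>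
        (\<forall>\<^sub>F x in joint_limit D. 0 \<le> u x \<and> 0 \<le> v x \<and>
           (case x of (\<delta>, t) \<Rightarrow> ?E \<delta> t) = u x powr r + v x powr (r / 2))"
    proof (rule split_sum_bigo)
      show "\<forall>\<^sub>F x in joint_limit D. 0 < (case x of (\<delta>, t) \<Rightarrow> \<delta> / t)
        \<and> 0 < (case x of (\<delta>, t) \<Rightarrow> \<delta> powr (2 * q / p - 1) / t) \<and> 0 \<le> (case x of (\<delta>, t) \<Rightarrow> ?E \<delta> t)
        \<and> (case x of (\<delta>, t) \<Rightarrow> ?E \<delta> t) \<le> C * ((case x of (\<delta>, t) \<Rightarrow> \<delta> / t) powr r
          + (case x of (\<delta>, t) \<Rightarrow> \<delta> powr (2 * q / p - 1) / t) powr (r / 2))"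
        using C(2) by (rule eventually_mono) auto
    qed (use r C in auto)
    then show "\<exists>u v. u \<in> O[joint_limit D](\<lambda>(\<delta>, t). \<delta> / t) \<and>
              v \<in> O[joint_limit D](\<lambda>(\<delta>, t). \<delta> powr (2 * q / max r 2 - 1) / t) \<and>
              (\<forall>\<^sub>F (\<delta>, t) in joint_limit D. 0 \<le> u (\<delta>, t) \<and> 0 \<le> v (\<delta>, t) \<and>
                 ?E \<delta> t = u (\<delta>, t) powr r + v (\<delta>, t) powr (r / 2))"
      by (simp add: case_prod_unfold p_def)
  qed
qed

end
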